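(* Let $n \ge 1$ be an integer, let $\epsilon > 0$ and let $c_1 > 0$. There exists a constant $C = C(n,\epsilon,c_1) > 0$, depending only on $n$, $\epsilon$ and $c_1$, such that the following holds. Let $f(x) = \alpha_n x^n + \dots + \alpha_1 x + \alpha_0$ be a polynomial of degree $n$ with real coefficients, let $\delta, X \in \mathbb{R}$ satisfy $0 \le \delta \le 1/4$ and $X \ge 2$, and let $$\Gamma_{\delta} := \{(x,y) \in \mathbb{R}^2 :\ x \in [X,2X],\ |y-f(x)| \le \delta\}, \qquad \mathcal{S} := \#(\Gamma_{\delta} \cap \mathbb{Z}^2).$$ Assume that the inequality $$\left|\alpha_n-\frac{r}{s}\right| \ge \frac{c_1}{s^{\frac{n+3}{2}}}$$ holds for all $r \in \mathbb{Z}$ and $s \in \mathbb{N}$. Then $$\mathcal{S} \le C\left(\delta^{\frac{2}{n(n+1)}}X+X^{\epsilon}\right).$$ Moreover, for $n = 1$ the second term $X^{\epsilon}$ can be replaced by $1$ (that is, for $n=1$ one has $\mathcal{S} \le C'(\delta X + 1)$ with a constant $C'>0$ depending only on $c_1$).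
   Context: $\mathbb{N}$ denotes the set of positive integers. *)

theory Defs
  imports Complex_Main "HOL-Computational_Algebra.Polynomial"
begin

definition curve_nbhd :: "real poly \<Rightarrow> real \<Rightarrow> real \<Rightarrow> (real \<times> real) set" where
  "curve_nbhd f \<delta> X = {(x, y). x \<in> {X..2*X} \<and> \<bar>y - poly f x\<bar> \<le> \<delta>}"

text \<open>The set below is finite (\<open>x\<close> and \<open>y\<close> are bounded), so \<^const>\<open>card\<close> is the true cardinality.\<close>

definition lattice_count :: "real poly \<Rightarrow> real \<Rightarrow> real \<Rightarrow> nat" where
  "lattice_count f \<delta> X = card (curve_nbhd f \<delta> X \<inter> \<int> \<times> \<int>)"

end

theory Submission
  imports Defs "HOL-Computational_Algebra.Primes" "HOL-Library.FuncSet"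
begin

text \<open>
  Write \<open>N = n (n + 1) / 2\<close> and let \<open>L\<close> be a small constant times \<open>\<delta> powr (- 1 / N)\<close>; the first term
  of the bound is then \<open>X / L\<close>, that is, boundedly many points per interval of length \<open>L\<close>. For \<open>n = 1\<close>
  this is immediate: two points with abscissae \<open>d\<close> apart give a fraction with denominator \<open>d\<close> within
  \<open>2 \<delta> / d\<close> of the slope, so \<open>d\<close> is at least a constant times \<open>1 / \<delta>\<close>. Let \<open>n \<ge> 2\<close>.

  Interpolate \<open>n + 1\<close> of the lattice points in an interval of length \<open>L\<close> by a polynomial \<open>g\<close> of degree at
  most \<open>n\<close>. Its coefficients are rational, with a common denominator \<open>q\<close> bounded by the Vandermonde product
  of the abscissae, hence by \<open>L powr N\<close>. At a further lattice point \<open>(x, y)\<close> the integer \<open>q (y - g x)\<close> has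
  absolute value below 1, because \<open>g\<close> and \<open>f\<close> are within \<open>\<delta>\<close> of each other at the nodes. So all lattice
  points over the interval lie on the graph of \<open>g\<close> (\<open>arc_on_interval\<close>).

  Two arithmetic facts about a polynomial \<open>g\<close> with integer values at a set \<open>B\<close> of integers drive
  the rest. By Lagrange's formula every prime power \<open>p ^ k\<close> dividing a denominator \<open>s\<close> of the leading
  coefficient (or the common denominator \<open>q\<close>) divides, for any \<open>n + 1\<close> points of \<open>B\<close>, the product of the
  differences between one of them and the \<open>n\<close> others; hence two of them agree modulo \<open>p ^ e\<close>, where
  \<open>e = \<lceil>k / n\<rceil>\<close>, and \<open>B\<close> meets at most \<open>n\<close> residue classes modulo \<open>p ^ e\<close>.

  (1) Combining all primes, a set \<open>B\<close> of diameter \<open>W\<close> has at most \<open>n ^ \<omega>(s) * (1 + W / s powr (1 / n))\<close>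
  elements (\<open>card_node_divisor_le\<close>), and \<open>n ^ \<omega>(s)\<close> is smaller than any power of \<open>s\<close>. When \<open>B\<close> contains
  \<open>n + 1\<close> points about \<open>W\<close> apart, the leading coefficients of \<open>f\<close> and \<open>g\<close> differ by at most a constant times
  \<open>\<delta> / W ^ n\<close>, and the Diophantine condition forces \<open>s\<close> to be large. The exponent \<open>(n + 3) / 2\<close> is exactly
  the one for which this gives \<open>W / s powr (1 / n)\<close> bounded by a constant times \<open>(W / L) powr \<theta>\<close> with
  \<open>\<theta> = (n + 1) / (n + 3) < 1\<close> (\<open>arc_card\<close>). This already yields the term \<open>X powr \<epsilon>\<close>.

  (2) If \<open>B\<close> has \<open>n\<^sup>2 + 1\<close> elements, then \<open>n + 1\<close> of them share a residue class. For these the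
  Vandermonde product is divisible by a higher power of \<open>p\<close> than the minimum guaranteed for all, and averaging
  over the \<open>(n + 1)\<close>-subsets of \<open>B\<close> gives \<open>q \<le> W powr (N (1 - \<eta>0))\<close> for some \<open>\<eta>0 > 0\<close> depending on \<open>n\<close>
  (\<open>denominator_saving\<close>). This strict saving is what avoids a loss of \<open>X powr \<epsilon>\<close> in the first term: an
  interval of length \<open>L\<close> with many lattice points has a denominator so small that \<open>g\<close> captures all
  lattice points within distance \<open>L powr (1 + \<eta>)\<close> for some \<open>\<eta> > 0\<close> (\<open>major_arc\<close>), and on such a long interval the
  factor \<open>(H / L) powr \<theta>\<close> of (1), with \<open>H = L powr (1 + \<eta>)\<close>, leaves room for \<open>H powr \<epsilon>\<close> below \<open>H / L\<close>.
  Covering \<open>[X, 2 X]\<close> by sparse intervals of length \<open>L\<close> and dense ones of length \<open>H\<close> completes the count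
  (\<open>near_points_card\<close>).
\<close>

section \<open>Lagrange interpolation at integer nodes\<close>

definition node_prod :: "int set \<Rightarrow> int \<Rightarrow> int" where
  "node_prod S i = (\<Prod>j\<in>S - {i}. i - j)"

text \<open>The absolute value of the discriminant of the monic polynomial with root set \<open>S\<close>, that is, the square of
  the Vandermonde product. Squaring avoids a choice of order on the pairs of nodes.\<close>

definition disc :: "int set \<Rightarrow> int" where
  "disc S = (\<Prod>i\<in>S. \<bar>node_prod S i\<bar>)"

lemma node_prod_nonzero:
  assumes "finite S"
  shows "node_prod S i \<noteq> 0"
  using assms by (auto simp: node_prod_def)

lemma disc_pos: "finite S \<Longrightarrow> disc S > 0"
  unfolding disc_def by (intro prod_pos) (simp add: node_prod_nonzero)

lemma abs_node_prod: "\<bar>node_prod S i\<bar> = (\<Prod>j\<in>S - {i}. \<bar>i - j\<bar>)"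
  by (simp add: node_prod_def abs_prod)

lemma disc_remove:
  assumes "finite S" "i \<in> S"
  shows "disc S = disc (S - {i}) * (node_prod S i)\<^sup>2"
proof -
  define T where "T = S - {i}"
  have T: "finite T" "i \<notin> T" "S = insert i T"
    using assms by (auto simp: T_def)
  have eq: "\<bar>node_prod S a\<bar> = \<bar>a - i\<bar> * \<bar>node_prod T a\<bar>" if "a \<in> T" for a
  proof -
    have "S - {a} = insert i (T - {a})" using that T by auto
    then show ?thesis using T by (simp add: abs_node_prod)
  qed
  have "disc S = \<bar>node_prod S i\<bar> * (\<Prod>a\<in>T. \<bar>node_prod S a\<bar>)"
    using T by (simp add: disc_def)
  also have "(\<Prod>a\<in>T. \<bar>node_prod S a\<bar>) = (\<Prod>a\<in>T. \<bar>i - a\<bar>) * disc T"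
    by (simp add: eq disc_def prod.distrib abs_minus_commute cong: prod.cong)
  also have "(\<Prod>a\<in>T. \<bar>i - a\<bar>) = \<bar>node_prod S i\<bar>"
    by (simp add: abs_node_prod T_def)
  finally show ?thesis
    unfolding T_def by (simp add: power2_eq_square abs_mult_self_eq flip: mult.assoc)
qed

lemma disc_le:
  assumes fin: "finite S" and W: "\<And>x y. x \<in> S \<Longrightarrow> y \<in> S \<Longrightarrow> \<bar>real_of_int (x - y)\<bar> \<le> W"
  shows "real_of_int (disc S) \<le> W ^ (card S * (card S - 1))"
proof -
  have "real_of_int (disc S) = (\<Prod>i\<in>S. \<Prod>j\<in>S - {i}. \<bar>real_of_int (i - j)\<bar>)"
    by (simp add: disc_def abs_node_prod of_int_diff[symmetric] del: of_int_diff)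
  also have "\<dots> \<le> (\<Prod>i\<in>S. \<Prod>j\<in>S - {i}. W)"
    using W by (intro prod_mono conjI prod_nonneg) auto
  also have "\<dots> = (\<Prod>i\<in>S. W ^ (card S - 1))"
    using fin by (intro prod.cong) simp_all
  also have "\<dots> = W ^ (card S * (card S - 1))"
    by (simp add: mult.commute flip: power_mult)
  finally show ?thesis .
qed

definition lagrange :: "int set \<Rightarrow> (int \<Rightarrow> real) \<Rightarrow> real poly" where
  "lagrange S v = (\<Sum>i\<in>S. smult (v i / real_of_int (node_prod S i)) (\<Prod>j\<in>S - {i}. [:- real_of_int j, 1:]))"

lemma poly_lagrange:
  "poly (lagrange S v) x = (\<Sum>i\<in>S. v i / node_prod S i * (\<Prod>j\<in>S - {i}. x - real_of_int j))"
  by (simp add: lagrange_def poly_sum poly_prod)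

lemma degree_prod_linear: "finite T \<Longrightarrow> degree (\<Prod>j\<in>T. [:- real_of_int j, 1:]) = card T"
  by (subst degree_prod_eq_sum_degree) auto

lemma lead_coeff_prod_linear:
  assumes "finite T"
  shows "coeff (\<Prod>j\<in>T. [:- real_of_int j, 1:]) (card T) = 1"
proof -
  have "lead_coeff (\<Prod>j\<in>T. [:- real_of_int j, 1:]) = 1"
    by (simp add: lead_coeff_prod)
  then show ?thesis using degree_prod_linear[OF assms] by simp
qed

lemma degree_lagrange:
  assumes "card S = Suc n"
  shows "degree (lagrange S v) \<le> n"
proof -
  have "finite S" using assms card.infinite by fastforce
  then show ?thesis unfolding lagrange_def
    using assms by (intro degree_sum_le order.trans[OF degree_smult_le]) (auto simp: degree_prod_linear)
qed

lemma coeff_lagrange: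
  assumes "card S = Suc n"
  shows "coeff (lagrange S v) n = (\<Sum>i\<in>S. v i / node_prod S i)"
proof -
  have fin: "finite S" using assms card.infinite by fastforce
  have "coeff (\<Prod>j\<in>S - {i}. [:- real_of_int j, 1:]) n = 1" if "i \<in> S" for i
    using lead_coeff_prod_linear[of "S - {i}"] fin that assms by simp
  then show ?thesis
    by (simp add: lagrange_def coeff_sum)
qed

lemma poly_lagrange_node:
  assumes "finite S" "x \<in> S"
  shows "poly (lagrange S v) (real_of_int x) = v x"
proof -
  have "(\<Sum>i\<in>S. v i / node_prod S i * (\<Prod>j\<in>S - {i}. real_of_int x - real_of_int j))
      = (\<Sum>i\<in>S. if i = x then v x else 0)"
  proof (rule sum.cong)
    fix i assume "i \<in> S"
    show "v i / node_prod S i * (\<Prod>j\<in>S - {i}. real_of_int x - real_of_int j)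
        = (if i = x then v x else 0)"
    proof (cases "i = x")
      case True
      have "(\<Prod>j\<in>S - {i}. real_of_int x - real_of_int j) = node_prod S i"
        using True by (simp add: node_prod_def)
      then show ?thesis using True node_prod_nonzero[OF assms(1), of i] by simp
    next
      case False
      then have "(\<Prod>j\<in>S - {i}. real_of_int x - real_of_int j) = 0"
        using assms by (intro prod_zero) auto
      then show ?thesis using False by simp
    qed
  qed simp
  then show ?thesis using assms by (simp add: poly_lagrange)
qed

lemma lagrange_eq:
  assumes "card S = Suc n" "degree g \<le> n"
  shows "lagrange S (\<lambda>i. poly g (real_of_int i)) = g"
proof -
  have fin: "finite S" using assms card.infinite by fastforce
  have card: "card (real_of_int ` S) = Suc n"
    using assms by (simp add: card_image inj_on_def)
  show ?thesis
    by (rule poly_eqI_degree[of "real_of_int ` S"])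
       (use assms card fin degree_lagrange[OF assms(1)] in \<open>auto simp: poly_lagrange_node le_imp_less_Suc\<close>)
qed

section \<open>Denominators of integer-valued interpolants\<close>

text \<open>The integers \<open>t\<close> with \<open>t Z \<subseteq> \<int>\<close> form an ideal; \<open>q\<close> is its positive generator.\<close>

definition is_denom :: "real set \<Rightarrow> int \<Rightarrow> bool" where
  "is_denom Z q \<longleftrightarrow> q > 0 \<and> (\<forall>t::int. (\<forall>z\<in>Z. of_int t * z \<in> \<int>) \<longleftrightarrow> q dvd t)"

lemma is_denom_exists:
  assumes "t0 \<noteq> 0" "\<And>z. z \<in> Z \<Longrightarrow> real_of_int t0 * z \<in> \<int>"
  obtains q where "is_denom Z q"
proof -
  define I where "I = {t::int. \<forall>z\<in>Z. real_of_int t * z \<in> \<int>}"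
  have lin: "a - b * c \<in> I" if "a \<in> I" "c \<in> I" for a b c
    using that by (auto simp: I_def left_diff_distrib mult.assoc intro!: Ints_diff Ints_mult[of "real_of_int b"])
  have "0 \<in> I" by (simp add: I_def)
  have "t0 \<in> I" using assms by (simp add: I_def)
  then have "\<bar>t0\<bar> \<in> I" using lin[OF \<open>0 \<in> I\<close>, of t0 1] by (cases "t0 \<ge> 0") auto
  then have ex: "\<exists>m::nat. m > 0 \<and> int m \<in> I"
    using assms(1) by (intro exI[of _ "nat \<bar>t0\<bar>"]) auto
  define m where "m = (LEAST m::nat. m > 0 \<and> int m \<in> I)"
  have m: "m > 0" "int m \<in> I" using LeastI_ex[OF ex] by (auto simp: m_def)
  have min: "k = 0" if "int k \<in> I" "k < m" for k
    using not_less_Least[of k "\<lambda>m. m > 0 \<and> int m \<in> I"] that by (auto simp: m_def)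
  have "t \<in> I \<longleftrightarrow> int m dvd t" for t
  proof
    assume "t \<in> I"
    then have "t mod int m \<in> I"
      using lin[OF _ m(2), of t "t div int m"] by (simp add: minus_div_mult_eq_mod)
    moreover have "t mod int m = int (nat (t mod int m))" "nat (t mod int m) < m"
      using m(1) by (auto simp: nat_less_iff)
    ultimately have "nat (t mod int m) = 0" using min by metis
    then show "int m dvd t"
      using \<open>t mod int m = int (nat (t mod int m))\<close> by (simp add: dvd_eq_mod_eq_0)
  next
    assume "int m dvd t"
    then obtain c where "t = c * int m" by (metis dvdE mult.commute)
    then show "t \<in> I" using lin[OF \<open>0 \<in> I\<close> m(2), of "- c"] by simp
  qed
  then have "is_denom Z (int m)" using m(1) by (auto simp: is_denom_def I_def)
  then show ?thesis by (rule that)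
qed

text \<open>The only property of denominators that the counting arguments use. It passes to subsets of \<open>B\<close>,
  and it holds for the common denominator of all coefficients of an interpolant as well as for the denominator
  of its leading coefficient.\<close>

definition node_divisor :: "nat \<Rightarrow> int \<Rightarrow> int set \<Rightarrow> bool" where
  "node_divisor n q B \<longleftrightarrow>
     (\<forall>S p k. S \<subseteq> B \<longrightarrow> card S = Suc n \<longrightarrow> prime p \<longrightarrow> p ^ k dvd q \<longrightarrow> (\<exists>i\<in>S. p ^ k dvd node_prod S i))"

lemma node_divisor_subset: "node_divisor n q B \<Longrightarrow> B' \<subseteq> B \<Longrightarrow> node_divisor n q B'"
  unfolding node_divisor_def by blast

lemma node_divisorE:
  assumes "node_divisor n q B" "S \<subseteq> B" "card S = Suc n" "prime p" "p ^ k dvd q"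
  obtains i where "i \<in> S" "p ^ k dvd node_prod S i"
  using assms unfolding node_divisor_def by blast

text \<open>A power \<open>p ^ k\<close> dividing none of the node products would allow a common multiple of them in which
  \<open>p\<close> occurs only to the power \<open>k - 1\<close>.\<close>

lemma node_divisorI:
  assumes "\<And>S t. S \<subseteq> B \<Longrightarrow> card S = Suc n \<Longrightarrow> (\<And>i. i \<in> S \<Longrightarrow> node_prod S i dvd t) \<Longrightarrow> q dvd t"
  shows "node_divisor n q B"
  unfolding node_divisor_def
proof (intro allI impI)
  fix S and p :: int and k
  assume S: "S \<subseteq> B" "card S = Suc n" and p: "prime p" and k: "p ^ k dvd q"
  have fin: "finite S" using S card.infinite by fastforce
  show "\<exists>i\<in>S. p ^ k dvd node_prod S i"
  proof (rule ccontr)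
    assume contra: "\<not> (\<exists>i\<in>S. p ^ k dvd node_prod S i)"
    have "\<forall>i\<in>S. \<exists>m. \<not> p dvd m \<and> node_prod S i dvd p ^ (k - 1) * m"
    proof
      fix i assume i: "i \<in> S"
      have nz: "node_prod S i \<noteq> 0" using fin by (rule node_prod_nonzero)
      obtain m where m: "node_prod S i = p ^ multiplicity p (node_prod S i) * m" "\<not> p dvd m"
        using multiplicity_decompose'[OF nz, of p] p not_prime_unit by blast
      have "multiplicity p (node_prod S i) < k"
        using contra i multiplicity_dvd'[of k p "node_prod S i"] by (auto simp: not_le[symmetric])
      then have "node_prod S i dvd p ^ (k - 1) * m"
        using m(1) by (metis Suc_diff_1 Suc_leI dvd_refl le_imp_power_dvd less_imp_Suc_add
            linorder_not_le mult_dvd_mono not_less_eq zero_less_Suc)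
      with m(2) show "\<exists>m. \<not> p dvd m \<and> node_prod S i dvd p ^ (k - 1) * m" by blast
    qed
    then obtain m where m: "\<And>i. i \<in> S \<Longrightarrow> \<not> p dvd m i"
      "\<And>i. i \<in> S \<Longrightarrow> node_prod S i dvd p ^ (k - 1) * m i" by metis
    have "node_prod S i dvd p ^ (k - 1) * (\<Prod>i\<in>S. m i)" if "i \<in> S" for i
      using m(2)[OF that] fin that by (meson dvd_prodI dvd_refl dvd_trans mult_dvd_mono)
    then have "q dvd p ^ (k - 1) * (\<Prod>i\<in>S. m i)" using assms S by blast
    then have "p ^ k dvd p ^ (k - 1) * (\<Prod>i\<in>S. m i)" using k dvd_trans by blast
    moreover have "k \<noteq> 0" using contra S(2) by (metis card.empty ex_in_conv nat.simps(3) one_dvd power_0)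
    then have "p ^ k = p ^ (k - 1) * p" by (metis power_minus_mult not_gr_zero)
    moreover have "p \<noteq> 0" using p by auto
    ultimately have "p dvd (\<Prod>i\<in>S. m i)" by simp
    then show False using prime_dvd_prod_iff[OF fin p] m(1) by blast
  qed
qed


lemma coeff_prod_linear_Ints: "finite T \<Longrightarrow> coeff (\<Prod>j\<in>T. [:- real_of_int j, 1:]) m \<in> \<int>"
proof (induction T arbitrary: m rule: finite_induct)
  case (insert j T)
  then show ?case
    by (auto simp: coeff_pCons split: nat.split intro!: Ints_mult Ints_add)
qed (auto simp: coeff_1)

text \<open>In Lagrange's formula the only denominators are the node products.\<close>

lemma clear_denominators:
  assumes S: "card S = Suc n" and deg: "degree g \<le> n"
    and int: "\<And>x. x \<in> S \<Longrightarrow> poly g (real_of_int x) \<in> \<int>"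
    and t: "\<And>i. i \<in> S \<Longrightarrow> node_prod S i dvd t"
  shows "real_of_int t * coeff g m \<in> \<int>"
proof -
  have fin: "finite S" using S card.infinite by fastforce
  have "of_int t * coeff g m
      = (\<Sum>i\<in>S. (real_of_int t / node_prod S i) * poly g (real_of_int i)
          * coeff (\<Prod>j\<in>S - {i}. [:- real_of_int j, 1:]) m)"
    by (subst lagrange_eq[OF S deg, symmetric])
       (simp add: lagrange_def coeff_sum sum_distrib_left mult_ac)
  also have "\<dots> \<in> \<int>"
  proof (intro Ints_sum Ints_mult coeff_prod_linear_Ints)
    fix i assume i: "i \<in> S"
    show "poly g (real_of_int i) \<in> \<int>" using int i by blast
    obtain c where "t = node_prod S i * c" using t[OF i] by blast
    then show "real_of_int t / node_prod S i \<in> \<int>"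
      using node_prod_nonzero[OF fin, of i] by simp
    show "finite (S - {i})" using fin by simp
  qed
  finally show ?thesis .
qed

lemma node_divisor_denom:
  assumes deg: "degree g \<le> n" and int: "\<And>x. x \<in> B \<Longrightarrow> poly g (real_of_int x) \<in> \<int>"
    and Z: "Z \<subseteq> range (coeff g)" and den: "is_denom Z q"
  shows "node_divisor n q B"
proof (rule node_divisorI)
  fix S t assume S: "S \<subseteq> B" "card S = Suc n" and t: "\<And>i. i \<in> S \<Longrightarrow> node_prod S i dvd t"
  have "of_int t * coeff g m \<in> \<int>" for m
    by (rule clear_denominators[OF S(2) deg]) (use int S t in auto)
  then show "q dvd t" using den Z unfolding is_denom_def by blast
qed

lemma denom_exists:
  assumes S: "card S = Suc n" and deg: "degree g \<le> n"
    and int: "\<And>x. x \<in> S \<Longrightarrow> poly g (real_of_int x) \<in> \<int>"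
    and Z: "Z \<subseteq> range (coeff g)"
  obtains q where "is_denom Z q"
proof -
  have fin: "finite S" using S card.infinite by fastforce
  have "real_of_int (\<Prod>i\<in>S. node_prod S i) * coeff g m \<in> \<int>" for m
    by (rule clear_denominators[OF S deg int]) (auto intro: dvd_prodI[OF fin])
  moreover have "(\<Prod>i\<in>S. node_prod S i) \<noteq> 0" using fin by (simp add: node_prod_nonzero)
  ultimately show ?thesis
    using is_denom_exists[of "\<Prod>i\<in>S. node_prod S i" Z] that Z by blast
qed

lemma dvd_by_prime_powers:
  fixes q N :: int
  assumes "q \<noteq> 0" "N \<noteq> 0"
    "\<And>p k. prime p \<Longrightarrow> k \<ge> 1 \<Longrightarrow> p ^ k dvd q \<Longrightarrow> p ^ (m * k) dvd N"
  shows "q ^ m dvd N"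
proof (rule multiplicity_le_imp_dvd)
  show "q ^ m \<noteq> 0" using assms by simp
  fix p :: int assume p: "prime p"
  have "p ^ (m * multiplicity p q) dvd N"
    using assms(3)[OF p, of "multiplicity p q"] multiplicity_dvd[of p q]
    by (cases "multiplicity p q = 0") auto
  then have "m * multiplicity p q \<le> multiplicity p N"
    using power_dvd_iff_le_multiplicity[of N p] assms(2) p not_prime_unit by auto
  moreover have "multiplicity p (q ^ m) = m * multiplicity p q"
    by (rule prime_elem_multiplicity_power_distrib) (use p assms in auto)
  ultimately show "multiplicity p (q ^ m) \<le> multiplicity p N" by simp
qed

lemma node_prod_square_dvd_disc:
  assumes "finite S" "i \<in> S" "d dvd node_prod S i"
  shows "d\<^sup>2 dvd disc S"
  using assms by (simp add: disc_remove[OF assms(1,2)] dvd_power_same)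

text \<open>Each node product occurs twice in the discriminant: once from its own node and once spread over the
  other nodes.\<close>

lemma square_dvd_disc:
  assumes "node_divisor n q S" "card S = Suc n" "q \<noteq> 0"
  shows "q\<^sup>2 dvd disc S"
proof (rule dvd_by_prime_powers)
  have fin: "finite S" using assms card.infinite by fastforce
  show "disc S \<noteq> 0" using disc_pos[OF fin] by simp
  fix p :: int and k assume p: "prime p" and k: "p ^ k dvd q"
  then obtain i where "i \<in> S" "p ^ k dvd node_prod S i"
    using assms unfolding node_divisor_def by blast
  then show "p ^ (2 * k) dvd disc S"
    using node_prod_square_dvd_disc[OF fin] by (metis power_mult mult.commute)
qed (use assms in auto)

section \<open>Counting points where a polynomial with given denominator is an integer\<close>

lemma ceiling_quotient:
  assumes "(n::nat) \<ge> 1" "(k::nat) \<ge> 1"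
  obtains e where "e \<ge> 1" "k \<le> n * e" "n * (e - 1) < k"
proof -
  define e where "e = (LEAST e. k \<le> n * e)"
  have ex: "k \<le> n * k" using assms by simp
  have 1: "k \<le> n * e" unfolding e_def using ex by (rule LeastI)
  then have 2: "e \<ge> 1" using assms by (cases e) auto
  then have "n * (e - 1) < k"
    using not_less_Least[of "e - 1" "\<lambda>e. k \<le> n * e"] by (auto simp: e_def[symmetric])
  with 1 2 show ?thesis using that by blast
qed

text \<open>Among \<open>n + 1\<close> pairwise incongruent points every node product would have \<open>p\<close>-adic valuation at
  most \<open>n (e - 1) < k\<close>.\<close>

lemma few_residues:
  fixes p :: int
  assumes div: "node_divisor n q B" and p: "prime p" "p ^ k dvd q"
    and e: "n * (e - 1) < k" "e \<ge> 1"
  shows "card ((\<lambda>x. x mod p ^ e) ` B) \<le> n"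
proof (rule ccontr)
  let ?r = "\<lambda>x. x mod p ^ e"
  assume "\<not> card (?r ` B) \<le> n"
  then obtain T where T: "T \<subseteq> ?r ` B" "card T = Suc n"
    by (meson not_less_eq_eq obtain_subset_with_card_n)
  then obtain S where S: "S \<subseteq> B" "inj_on ?r S" "T = ?r ` S"
    by (metis subset_image_inj)
  have card: "card S = Suc n" using S T by (simp add: card_image)
  then have fin: "finite S" using card.infinite by fastforce
  obtain i where i: "i \<in> S" "p ^ k dvd node_prod S i"
    using div S card p unfolding node_divisor_def by blast
  have "k \<le> multiplicity p (node_prod S i)"
    using i(2) node_prod_nonzero[OF fin, of i] p not_prime_unit
    by (subst (asm) power_dvd_iff_le_multiplicity) auto
  also have "\<dots> = (\<Sum>j\<in>S - {i}. multiplicity p (i - j))"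
    unfolding node_prod_def using fin p
    by (subst prime_elem_multiplicity_prod_distrib) (auto simp: prime_imp_prime_elem)
  also have "\<dots> \<le> (\<Sum>j\<in>S - {i}. e - 1)"
  proof (rule sum_mono)
    fix j assume j: "j \<in> S - {i}"
    have "\<not> p ^ e dvd i - j"
      using S(2) i j by (auto simp: mod_eq_dvd_iff[symmetric] inj_on_def)
    then have "multiplicity p (i - j) < e"
      by (meson multiplicity_dvd' not_le)
    then show "multiplicity p (i - j) \<le> e - 1" by simp
  qed
  also have "\<dots> = n * (e - 1)" using fin i card by simp
  finally show False using e by simp
qed

lemma card_congruent_le:
  fixes F :: "int set"
  assumes fin: "finite F" and Q: "Q > 0" and W: "W \<ge> 0"
    and cong: "\<And>x y. x \<in> F \<Longrightarrow> y \<in> F \<Longrightarrow> Q dvd x - y"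
    and diam: "\<And>x y. x \<in> F \<Longrightarrow> y \<in> F \<Longrightarrow> \<bar>real_of_int (x - y)\<bar> \<le> W"
  shows "real (card F) \<le> 1 + W / real_of_int Q"
proof (cases "F = {}")
  case True
  then show ?thesis using Q W by simp
next
  case False
  define m where "m = Min F"
  have m: "m \<in> F" "\<And>x. x \<in> F \<Longrightarrow> m \<le> x" using fin False by (auto simp: m_def)
  define \<phi> where "\<phi> x = (x - m) div Q" for x
  have \<phi>: "x = m + Q * \<phi> x" if "x \<in> F" for x
    using cong[OF that m(1)] by (simp add: \<phi>_def)
  have "inj_on \<phi> F" by (rule inj_onI) (metis \<phi>)
  then have "card F = card (\<phi> ` F)" by (simp add: card_image)
  also have "\<phi> ` F \<subseteq> {0..\<lfloor>W / Q\<rfloor>}"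
  proof
    fix z assume "z \<in> \<phi> ` F"
    then obtain x where x: "x \<in> F" "z = \<phi> x" by blast
    have "real_of_int Q * real_of_int z \<le> W"
      using diam[OF x(1) m(1)] \<phi>[OF x(1)] x(2)
      by (metis abs_le_D1 add_diff_cancel_left' of_int_mult)
    then have "real_of_int z \<le> W / Q" using Q by (simp add: pos_le_divide_eq mult.commute)
    moreover have "z \<ge> 0" using m(2)[OF x(1)] Q x(2) by (simp add: \<phi>_def pos_imp_zdiv_nonneg_iff)
    ultimately show "z \<in> {0..\<lfloor>W / Q\<rfloor>}" by (simp add: le_floor_iff)
  qed
  then have "card (\<phi> ` F) \<le> card {0..\<lfloor>W / Q\<rfloor>}" by (intro card_mono) auto
  also have "real (card {0..\<lfloor>W / Q\<rfloor>}) = 1 + real_of_int \<lfloor>W / Q\<rfloor>" using W Q by simp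
  finally show ?thesis by linarith
qed

lemma prod_prime_powers_dvd:
  fixes c :: int
  assumes "finite P" "\<And>p. p \<in> P \<Longrightarrow> prime p" "\<And>p. p \<in> P \<Longrightarrow> p ^ e p dvd c"
  shows "(\<Prod>p\<in>P. p ^ e p) dvd c"
  using assms
proof (induction P rule: finite_induct)
  case (insert p P)
  have "coprime (p ^ e p) (\<Prod>p\<in>P. p ^ e p)"
  proof (rule prod_coprime_right)
    fix r assume "r \<in> P"
    then have "coprime p r" using insert by (intro primes_coprime) auto
    then show "coprime (p ^ e p) (r ^ e r)" by simp
  qed
  then show ?case using insert by (simp add: divides_mult)
qed simp

text \<open>With \<open>e p\<close> the least integer such that \<open>n * e p\<close> is at least the multiplicity of \<open>p\<close> in \<open>q\<close>, the points
  occupy at most \<open>n\<close> classes modulo each \<open>p ^ e p\<close>. Points in the same class for all \<open>p\<close> are congruent modulo the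
  product \<open>Q\<close> of these prime powers, and \<open>Q ^ n \<ge> q\<close>.\<close>

lemma card_node_divisor_le:
  assumes fin: "finite B" and div: "node_divisor n q B" and q: "q > 0" and n: "n \<ge> 1"
    and W: "W \<ge> 0" and diam: "\<And>x y. x \<in> B \<Longrightarrow> y \<in> B \<Longrightarrow> \<bar>real_of_int (x - y)\<bar> \<le> W"
  shows "real (card B) \<le> real n ^ card (prime_factors q) * (1 + W / real_of_int q powr (1 / n))"
proof -
  define P where "P = prime_factors q"
  have P: "prime p" "multiplicity p q \<ge> 1" if "p \<in> P" for p
    using that q by (auto simp: P_def prime_factors_multiplicity)
  have finP: "finite P" by (simp add: P_def)
  have "\<forall>p\<in>P. \<exists>e. e \<ge> 1 \<and> multiplicity p q \<le> n * e \<and> n * (e - 1) < multiplicity p q"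
    using P n ceiling_quotient by metis
  then obtain e where e: "\<And>p. p \<in> P \<Longrightarrow> e p \<ge> 1" "\<And>p. p \<in> P \<Longrightarrow> multiplicity p q \<le> n * e p"
    "\<And>p. p \<in> P \<Longrightarrow> n * (e p - 1) < multiplicity p q" by metis
  define Q where "Q = (\<Prod>p\<in>P. p ^ e p)"
  have Q0: "Q > 0" unfolding Q_def
    using P by (intro prod_pos) (auto simp: prime_gt_0_int)
  have "q ^ 1 dvd Q ^ n"
  proof (rule dvd_by_prime_powers)
    fix p :: int and k assume p: "prime p" "k \<ge> 1" "p ^ k dvd q"
    then have k: "k \<le> multiplicity p q"
      using q not_prime_unit by (subst (asm) power_dvd_iff_le_multiplicity) auto
    with p q have pP: "p \<in> P" by (auto simp: P_def prime_factors_multiplicity)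
    have "p ^ e p dvd Q" unfolding Q_def using finP pP by (rule dvd_prodI)
    then have "p ^ (e p * n) dvd Q ^ n" by (simp add: power_mult dvd_power_same)
    moreover have "p ^ (1 * k) dvd p ^ (e p * n)"
      using e(2)[OF pP] k by (intro le_imp_power_dvd) (simp add: mult.commute)
    ultimately show "p ^ (1 * k) dvd Q ^ n" using dvd_trans by blast
  qed (use q Q0 in auto)
  then have "q \<le> Q ^ n" using Q0 by (intro zdvd_imp_le) auto
  then have "real_of_int q \<le> real_of_int Q ^ n" by (metis of_int_le_iff of_int_power)
  then have "real_of_int q powr (1 / n) \<le> (real_of_int Q ^ n) powr (1 / n)"
    using q by (intro powr_mono2) auto
  also have "\<dots> = real_of_int Q"
    using Q0 n by (simp add: powr_powr flip: powr_realpow)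
  finally have Qq: "real_of_int q powr (1 / n) \<le> real_of_int Q" .
  define \<phi> where "\<phi> x = (\<lambda>p\<in>P. x mod p ^ e p)" for x
  have fiber: "real (card {x\<in>B. \<phi> x = c}) \<le> 1 + W / real_of_int Q" for c
  proof (rule card_congruent_le)
    fix x y assume x: "x \<in> {x\<in>B. \<phi> x = c}" and y: "y \<in> {x\<in>B. \<phi> x = c}"
    show "\<bar>real_of_int (x - y)\<bar> \<le> W" using x y diam by simp
    have "p ^ e p dvd x - y" if "p \<in> P" for p
    proof -
      have "\<phi> x p = \<phi> y p" using x y by simp
      then show ?thesis using that by (simp add: \<phi>_def mod_eq_dvd_iff)
    qed
    then show "Q dvd x - y" unfolding Q_def
      using P finP by (intro prod_prime_powers_dvd) auto
  qed (use fin Q0 W in auto)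
  have "card (\<phi> ` B) \<le> card (PiE P (\<lambda>p. (\<lambda>x. x mod p ^ e p) ` B))"
    using fin finP by (intro card_mono finite_PiE) (auto simp: \<phi>_def PiE_def)
  also have "\<dots> = (\<Prod>p\<in>P. card ((\<lambda>x. x mod p ^ e p) ` B))"
    using finP by (rule card_PiE)
  also have "\<dots> \<le> (\<Prod>p\<in>P. n)"
  proof (intro prod_mono conjI)
    fix p assume p: "p \<in> P"
    show "card ((\<lambda>x. x mod p ^ e p) ` B) \<le> n"
      using few_residues[OF div P(1)[OF p] multiplicity_dvd e(3)[OF p] e(1)[OF p]] .
  qed simp
  finally have img: "card (\<phi> ` B) \<le> n ^ card P" by simp
  have "B = (\<Union>c\<in>\<phi> ` B. {x\<in>B. \<phi> x = c})" by auto
  then have "card B \<le> (\<Sum>c\<in>\<phi> ` B. card {x\<in>B. \<phi> x = c})"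
    using card_UN_le[of "\<phi> ` B" "\<lambda>c. {x\<in>B. \<phi> x = c}"] fin by simp
  then have "real (card B) \<le> (\<Sum>c\<in>\<phi> ` B. real (card {x\<in>B. \<phi> x = c}))"
    by (simp flip: of_nat_sum)
  also have "\<dots> \<le> (\<Sum>c\<in>\<phi> ` B. 1 + W / real_of_int Q)" by (intro sum_mono fiber)
  also have "\<dots> = real (card (\<phi> ` B)) * (1 + W / real_of_int Q)" by simp
  also have "\<dots> \<le> real n ^ card P * (1 + W / real_of_int q powr (1 / n))"
  proof (rule mult_mono)
    show "real (card (\<phi> ` B)) \<le> real n ^ card P" using img by (metis of_nat_le_iff of_nat_power)
    show "1 + W / real_of_int Q \<le> 1 + W / real_of_int q powr (1 / n)"
      using Qq q Q0 W by (intro add_left_mono divide_left_mono) auto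
  qed (use Q0 W in auto)
  finally show ?thesis by (simp add: P_def)
qed

text \<open>A prime \<open>p\<close> with \<open>p powr \<epsilon> \<ge> n\<close> pays for its own factor \<open>n\<close>; the finitely many smaller primes contribute
  a bounded factor.\<close>

lemma power_omega_le:
  fixes \<epsilon> :: real and n :: nat
  assumes n: "n \<ge> 1" and \<epsilon>: "\<epsilon> > 0"
  shows "\<exists>C\<ge>1. \<forall>q::int. q > 0 \<longrightarrow> real n ^ card (prime_factors q) \<le> C * real_of_int q powr \<epsilon>"
proof -
  define b :: int where "b = \<lceil>real n powr (1 / \<epsilon>)\<rceil>"
  define C where "C = real n ^ card {1..b}"
  have "C \<ge> 1" using n by (simp add: C_def)
  moreover have "real n ^ card (prime_factors q) \<le> C * real_of_int q powr \<epsilon>" if q: "q > 0" for q :: int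
  proof -
    define P where "P = prime_factors q"
    have finP: "finite P" by (simp add: P_def)
    have P: "prime p" "p \<ge> 1" "p dvd q" if "p \<in> P" for p
      using that prime_ge_1_int by (auto simp: P_def in_prime_factors_iff)
    let ?w = "\<lambda>p. if p \<le> b then real n else 1"
    have "real n ^ card P = (\<Prod>p\<in>P. real n)" by simp
    also have "\<dots> \<le> (\<Prod>p\<in>P. ?w p * real_of_int p powr \<epsilon>)"
    proof (intro prod_mono conjI)
      fix p assume p: "p \<in> P"
      have p1: "real_of_int p powr \<epsilon> \<ge> 1" using P(2)[OF p] \<epsilon> by (intro ge_one_powr_ge_zero) auto
      show "real n \<le> ?w p * real_of_int p powr \<epsilon>"
      proof (cases "p \<le> b")
        case True
        then show ?thesis using p1 n by simp
      next
        case False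
        then have "real n powr (1 / \<epsilon>) \<le> real_of_int p" by (simp add: b_def not_le ceiling_less_iff)
        then have "(real n powr (1 / \<epsilon>)) powr \<epsilon> \<le> real_of_int p powr \<epsilon>"
          using \<epsilon> by (intro powr_mono2) auto
        then show ?thesis using False n \<epsilon> by (simp add: powr_powr)
      qed
    qed simp
    also have "\<dots> = (\<Prod>p\<in>P. ?w p) * (\<Prod>p\<in>P. real_of_int p powr \<epsilon>)" by (rule prod.distrib)
    also have "\<dots> \<le> C * real_of_int q powr \<epsilon>"
    proof (rule mult_mono)
      have "(\<Prod>p\<in>P. ?w p) = real n ^ card {p\<in>P. p \<le> b}"
        using finP by (simp add: prod.If_cases Int_def)
      also have "\<dots> \<le> C" unfolding C_def
        using n P(2) by (intro power_increasing card_mono) auto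
      finally show "(\<Prod>p\<in>P. ?w p) \<le> C" .
      have "(\<Prod>p\<in>P. real_of_int p powr \<epsilon>) = real_of_int (\<Prod>p\<in>P. p) powr \<epsilon>"
        unfolding of_int_prod
        by (rule prod_powr_distrib[symmetric])
      moreover have "(\<Prod>p\<in>P. p ^ 1) dvd q"
        using finP P by (intro prod_prime_powers_dvd) auto
      then have "(\<Prod>p\<in>P. p) \<le> q" using q by (intro zdvd_imp_le) auto
      moreover have "(\<Prod>p\<in>P. p) \<ge> 0" using P(2) by (intro prod_nonneg) force
      ultimately show "(\<Prod>p\<in>P. real_of_int p powr \<epsilon>) \<le> real_of_int q powr \<epsilon>"
        using \<epsilon> by (simp add: powr_mono2 flip: of_int_prod)
      show "0 \<le> (\<Prod>p\<in>P. real_of_int p powr \<epsilon>)" by (intro prod_nonneg) simp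
    qed (use \<open>C \<ge> 1\<close> in simp)
    finally show ?thesis by (simp add: P_def)
  qed
  ultimately show ?thesis by blast
qed

section \<open>A power saving for denominators with more than \<open>n\<^sup>2\<close> points\<close>

lemma cluster_pow_dvd_disc:
  fixes d :: int
  assumes "finite S" "card S = Suc n" "\<And>x y. x \<in> S \<Longrightarrow> y \<in> S \<Longrightarrow> d dvd x - y"
  shows "d ^ (n * (n + 1)) dvd disc S"
proof -
  have "d ^ n dvd \<bar>node_prod S i\<bar>" if "i \<in> S" for i
  proof -
    have "(\<Prod>j\<in>S - {i}. d) dvd (\<Prod>j\<in>S - {i}. i - j)"
      using assms that by (intro prod_dvd_prod) auto
    then show ?thesis using assms that by (simp add: node_prod_def)
  qed
  then have "(\<Prod>i\<in>S. d ^ n) dvd disc S" unfolding disc_def by (rule prod_dvd_prod)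
  then show ?thesis using assms(2) by (simp add: power_add power_mult)
qed

text \<open>For \<open>p ^ k\<close> dividing \<open>q\<close>, every factor of the product is divisible by \<open>p ^ (2 k)\<close>. Since the points occupy
  at most \<open>n\<close> classes modulo \<open>p ^ e\<close>, some class contains \<open>n + 1\<close> of them, and for this subset all
  differences are divisible by \<open>p ^ e\<close>, which makes its discriminant divisible by \<open>p ^ (3 k)\<close> as soon as
  \<open>n \<ge> 2\<close>. The extra factor \<open>p ^ k\<close> is the \<open>+ 1\<close> in the exponent.\<close>

lemma pow_dvd_prod_disc:
  assumes n: "n \<ge> 2" and fin: "finite B" and card: "card B = n\<^sup>2 + 1"
    and div: "node_divisor n q B" and q: "q \<noteq> 0"
  shows "q ^ (2 * ((n\<^sup>2 + 1) choose (n + 1)) + 1) dvd (\<Prod>S | S \<subseteq> B \<and> card S = n + 1. disc S)"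
proof (rule dvd_by_prime_powers)
  let ?F = "{S. S \<subseteq> B \<and> card S = n + 1}" and ?C = "(n\<^sup>2 + 1) choose (n + 1)"
  have finS: "finite S" if "S \<in> ?F" for S using that fin finite_subset by blast
  have finF: "finite ?F" using fin by simp
  have cardF: "card ?F = ?C" using n_subsets[OF fin, of "n + 1"] card by simp
  show "(\<Prod>S\<in>?F. disc S) \<noteq> 0"
    using finS disc_pos finF by (metis (no_types, lifting) less_irrefl prod_zero_iff)
  fix p :: int and k assume p: "prime p" and k: "k \<ge> 1" "p ^ k dvd q"
  obtain e where e: "e \<ge> 1" "k \<le> n * e" "n * (e - 1) < k"
    using ceiling_quotient[of n k] n k by auto
  let ?r = "\<lambda>x. x mod p ^ e"
  have few: "card (?r ` B) \<le> n" using few_residues[OF div p k(2) e(3,1)] .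
  have "\<exists>c\<in>?r ` B. card {x\<in>B. ?r x = c} \<ge> n + 1"
  proof (rule ccontr)
    assume "\<not> ?thesis"
    then have "(\<Sum>c\<in>?r ` B. card {x\<in>B. ?r x = c}) \<le> (\<Sum>c\<in>?r ` B. n)"
      by (intro sum_mono) auto
    moreover have "B = (\<Union>c\<in>?r ` B. {x\<in>B. ?r x = c})" by auto
    then have "card B \<le> (\<Sum>c\<in>?r ` B. card {x\<in>B. ?r x = c})"
      using card_UN_le[of "?r ` B" "\<lambda>c. {x\<in>B. ?r x = c}"] fin by simp
    ultimately have "card B \<le> card (?r ` B) * n" by simp
    also have "\<dots> \<le> n * n" using few by simp
    finally have "card B \<le> n * n" .
    then show False using card by (simp add: power2_eq_square)
  qed
  then obtain c where "card {x\<in>B. ?r x = c} \<ge> n + 1" by blast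
  then obtain S0 where S0: "S0 \<subseteq> {x\<in>B. ?r x = c}" "card S0 = n + 1"
    by (meson obtain_subset_with_card_n)
  then have S0F: "S0 \<in> ?F" by auto
  have "(p ^ e) ^ (n * (n + 1)) dvd disc S0"
    using S0 finS[OF S0F] by (intro cluster_pow_dvd_disc) (auto simp: mod_eq_dvd_iff[symmetric])
  moreover have "3 * k \<le> e * (n * (n + 1))"
  proof -
    have "3 * k \<le> (n + 1) * k" using n by simp
    also have "\<dots> \<le> (n + 1) * (n * e)" using e(2) by (rule mult_le_mono2)
    finally show ?thesis by (simp add: mult_ac)
  qed
  then have "p ^ (3 * k) dvd (p ^ e) ^ (n * (n + 1))"
    by (simp add: le_imp_power_dvd flip: power_mult)
  ultimately have big: "p ^ (3 * k) dvd disc S0" using dvd_trans by blast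
  have small: "p ^ (2 * k) dvd disc S" if "S \<in> ?F" for S
  proof -
    have "S \<subseteq> B" "card S = Suc n" using that by auto
    then obtain i where "i \<in> S" "p ^ k dvd node_prod S i"
      using node_divisorE[OF div _ _ p k(2)] by blast
    then show ?thesis
      using node_prod_square_dvd_disc[OF finS[OF that]] by (metis power_mult mult.commute)
  qed
  have "(\<Prod>S\<in>?F - {S0}. p ^ (2 * k)) dvd (\<Prod>S\<in>?F - {S0}. disc S)"
    using small by (intro prod_dvd_prod) auto
  then have "p ^ (3 * k) * p ^ (2 * k * (?C - 1)) dvd disc S0 * (\<Prod>S\<in>?F - {S0}. disc S)"
    using big S0F finF cardF by (intro mult_dvd_mono) (simp_all add: power_mult)
  also have "disc S0 * (\<Prod>S\<in>?F - {S0}. disc S) = (\<Prod>S\<in>?F. disc S)"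
    using finF S0F by (simp add: prod.remove)
  also have "p ^ (3 * k) * p ^ (2 * k * (?C - 1)) = p ^ ((2 * ?C + 1) * k)"
  proof -
    have "?C \<ge> 1" using cardF S0F finF by (metis One_nat_def Suc_leI card_gt_0_iff empty_iff)
    moreover have "3 * k + 2 * k * (m - 1) = (2 * m + 1) * k" if "m \<ge> 1" for m
      using that by (cases m) (auto simp: algebra_simps)
    ultimately have "3 * k + 2 * k * (?C - 1) = (2 * ?C + 1) * k" by blast
    then show ?thesis by (metis power_add)
  qed
  finally show "p ^ ((2 * ?C + 1) * k) dvd (\<Prod>S\<in>?F. disc S)" .
qed (use q in simp)

lemma denominator_saving:
  assumes n: "n \<ge> 2" and fin: "finite B" and card: "card B = n\<^sup>2 + 1"
    and div: "node_divisor n q B" and q: "q > 0"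
    and diam: "\<And>x y. x \<in> B \<Longrightarrow> y \<in> B \<Longrightarrow> \<bar>real_of_int (x - y)\<bar> \<le> W"
  shows "real_of_int q ^ (2 * ((n\<^sup>2 + 1) choose (n + 1)) + 1) \<le> W ^ (n * (n + 1) * ((n\<^sup>2 + 1) choose (n + 1)))"
proof -
  let ?F = "{S. S \<subseteq> B \<and> card S = n + 1}" and ?C = "(n\<^sup>2 + 1) choose (n + 1)"
  have finS: "finite S" if "S \<in> ?F" for S using that fin finite_subset by blast
  have cardF: "card ?F = ?C" using n_subsets[OF fin, of "n + 1"] card by simp
  have "0 < (\<Prod>S\<in>?F. disc S)" using finS disc_pos by (intro prod_pos) blast
  then have "q ^ (2 * ?C + 1) \<le> (\<Prod>S\<in>?F. disc S)"
    using pow_dvd_prod_disc[OF n fin card div] q by (intro zdvd_imp_le) auto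
  then have "real_of_int (q ^ (2 * ?C + 1)) \<le> real_of_int (\<Prod>S\<in>?F. disc S)"
    by (simp only: of_int_le_iff)
  also have "\<dots> = (\<Prod>S\<in>?F. real_of_int (disc S))" by simp
  also have "\<dots> \<le> (\<Prod>S\<in>?F. W ^ (n * (n + 1)))"
  proof (intro prod_mono conjI)
    fix S assume S: "S \<in> ?F"
    show "0 \<le> real_of_int (disc S)" using disc_pos[OF finS[OF S]] by simp
    have "real_of_int (disc S) \<le> W ^ (card S * (card S - 1))"
      using S by (intro disc_le finS diam) auto
    then show "real_of_int (disc S) \<le> W ^ (n * (n + 1))" using S by (simp add: mult.commute)
  qed
  also have "\<dots> = W ^ (n * (n + 1) * ?C)" using cardF by (simp add: power_mult)
  finally show ?thesis by simp
qed

section \<open>Comparing a polynomial with an interpolant\<close>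

text \<open>The Lebesgue function of the node set \<open>S\<close>: the factor by which interpolation can amplify an error at
  the nodes when it is transported to \<open>x\<close>.\<close>

definition node_weight :: "int set \<Rightarrow> int \<Rightarrow> real" where
  "node_weight S x = (\<Sum>i\<in>S. (\<Prod>j\<in>S - {i}. \<bar>real_of_int (x - j)\<bar>) / \<bar>real_of_int (node_prod S i)\<bar>)"

lemma interpolation_bound:
  assumes S: "card S = Suc n" and deg: "degree h \<le> n"
    and small: "\<And>i. i \<in> S \<Longrightarrow> \<bar>poly h (real_of_int i)\<bar> \<le> \<delta>"
  shows "\<bar>poly h (real_of_int x)\<bar> \<le> \<delta> * node_weight S x"
    and "\<bar>coeff h n\<bar> \<le> \<delta> * (\<Sum>i\<in>S. 1 / \<bar>real_of_int (node_prod S i)\<bar>)"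
proof -
  let ?h = "\<lambda>i. poly h (real_of_int i)"
  have "?h x = (\<Sum>i\<in>S. ?h i / node_prod S i * (\<Prod>j\<in>S - {i}. real_of_int x - real_of_int j))"
    by (subst lagrange_eq[OF S deg, symmetric]) (rule poly_lagrange)
  also have "\<bar>\<dots>\<bar> \<le> (\<Sum>i\<in>S. \<delta> / \<bar>real_of_int (node_prod S i)\<bar> * (\<Prod>j\<in>S - {i}. \<bar>real_of_int (x - j)\<bar>))"
    using small
    by (intro order.trans[OF sum_abs] sum_mono)
       (auto simp: abs_mult abs_prod intro!: mult_right_mono divide_right_mono prod_nonneg)
  also have "\<dots> = \<delta> * node_weight S x"
    by (simp add: node_weight_def sum_distrib_left)
  finally show "\<bar>?h x\<bar> \<le> \<delta> * node_weight S x" .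
  have "coeff h n = (\<Sum>i\<in>S. ?h i / node_prod S i)"
    by (subst lagrange_eq[OF S deg, symmetric]) (rule coeff_lagrange[OF S])
  also have "\<bar>\<dots>\<bar> \<le> (\<Sum>i\<in>S. \<delta> / \<bar>real_of_int (node_prod S i)\<bar>)"
    using small by (intro order.trans[OF sum_abs] sum_mono) (auto intro!: divide_right_mono)
  also have "\<dots> = \<delta> * (\<Sum>i\<in>S. 1 / \<bar>real_of_int (node_prod S i)\<bar>)"
    by (simp add: sum_distrib_left)
  finally show "\<bar>coeff h n\<bar> \<le> \<delta> * (\<Sum>i\<in>S. 1 / \<bar>real_of_int (node_prod S i)\<bar>)" .
qed

lemma denom_poly_Ints:
  assumes "is_denom (range (coeff g)) q"
  shows "real_of_int q * poly g (real_of_int x) \<in> \<int>"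
proof -
  have c: "real_of_int q * coeff g i \<in> \<int>" for i
    using assms dvd_refl[of q] unfolding is_denom_def by (metis rangeI)
  have "real_of_int q * poly g (real_of_int x) = (\<Sum>i\<le>degree g. (real_of_int q * coeff g i) * real_of_int x ^ i)"
    by (simp add: poly_altdef sum_distrib_left mult.assoc)
  also have "\<dots> \<in> \<int>" by (intro Ints_sum Ints_mult[OF c]) auto
  finally show ?thesis .
qed

text \<open>The number \<open>q (y - g x)\<close> is an integer of absolute value less than 1.\<close>

lemma interpolant_continues:
  assumes S: "card S = Suc n" and deg: "degree f \<le> n" "degree g \<le> n"
    and close: "\<And>i. i \<in> S \<Longrightarrow> \<bar>poly f (real_of_int i) - poly g (real_of_int i)\<bar> \<le> \<delta>"
    and den: "is_denom (range (coeff g)) q"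
    and y: "y \<in> \<int>" "\<bar>y - poly f (real_of_int x)\<bar> \<le> \<delta>"
    and small: "real_of_int q * \<delta> * (1 + node_weight S x) < 1"
  shows "poly g (real_of_int x) = y"
proof -
  have q: "q > 0" using den by (simp add: is_denom_def)
  have "\<bar>poly (f - g) (real_of_int x)\<bar> \<le> \<delta> * node_weight S x"
    by (rule interpolation_bound(1)[OF S]) (use close deg in \<open>auto intro: degree_diff_le\<close>)
  then have "\<bar>y - poly g (real_of_int x)\<bar> \<le> \<delta> * (1 + node_weight S x)"
    using y(2) by (simp add: distrib_left)
  then have "real_of_int q * \<bar>y - poly g (real_of_int x)\<bar> \<le> real_of_int q * (\<delta> * (1 + node_weight S x))"
    using q by (intro mult_left_mono) auto
  then have "real_of_int q * \<bar>y - poly g (real_of_int x)\<bar> < 1"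
    using small unfolding mult.assoc by (rule le_less_trans)
  then have "\<bar>real_of_int q * y - real_of_int q * poly g (real_of_int x)\<bar> < 1"
    using q by (simp add: abs_mult flip: right_diff_distrib)
  moreover have "real_of_int q * y - real_of_int q * poly g (real_of_int x) \<in> \<int>"
    by (intro Ints_diff denom_poly_Ints[OF den] Ints_mult[OF _ y(1)]) simp
  ultimately have "real_of_int q * y - real_of_int q * poly g (real_of_int x) = 0"
    using Ints_nonzero_abs_less1 by blast
  then show ?thesis using q by simp
qed

section \<open>Separated nodes and the Diophantine condition\<close>

definition separated :: "real \<Rightarrow> int set \<Rightarrow> bool" where
  "separated \<kappa> S \<longleftrightarrow> (\<forall>x\<in>S. \<forall>y\<in>S. x \<noteq> y \<longrightarrow> \<kappa> \<le> \<bar>real_of_int (x - y)\<bar>)"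

definition diam_le :: "int set \<Rightarrow> real \<Rightarrow> bool" where
  "diam_le B W \<longleftrightarrow> (\<forall>x\<in>B. \<forall>y\<in>B. \<bar>real_of_int (x - y)\<bar> \<le> W)"

lemma diam_leD: "diam_le B W \<Longrightarrow> x \<in> B \<Longrightarrow> y \<in> B \<Longrightarrow> \<bar>real_of_int (x - y)\<bar> \<le> W"
  by (auto simp: diam_le_def)

lemma diam_le_subset: "diam_le B W \<Longrightarrow> B' \<subseteq> B \<Longrightarrow> diam_le B' W"
  by (auto simp: diam_le_def)

lemma separated_one: "separated 1 S"
proof -
  have "1 \<le> \<bar>real_of_int (x - y)\<bar>" if "x \<noteq> y" for x y :: int
  proof -
    have "1 \<le> \<bar>x - y\<bar>" using that by simp
    then show ?thesis by (metis of_int_1_le_iff of_int_abs)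
  qed
  then show ?thesis by (auto simp: separated_def)
qed

lemma node_prod_ge:
  assumes "card S = Suc n" "i \<in> S" "separated \<kappa> S" "\<kappa> \<ge> 0"
  shows "\<kappa> ^ n \<le> \<bar>real_of_int (node_prod S i)\<bar>"
proof -
  have "\<kappa> ^ n = (\<Prod>j\<in>S - {i}. \<kappa>)" using assms by (simp add: card_Diff_singleton)
  also have "\<dots> \<le> (\<Prod>j\<in>S - {i}. \<bar>real_of_int (i - j)\<bar>)"
    using assms by (intro prod_mono) (auto simp: separated_def)
  also have "\<dots> = \<bar>real_of_int (node_prod S i)\<bar>"
    by (simp add: node_prod_def abs_prod)
  finally show ?thesis .
qed

text \<open>A \<open>\<kappa>\<close>-separated subset of maximal size is \<open>\<kappa>\<close>-dense. If it has at most \<open>n\<close> elements, then one of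
  the corresponding balls contains at least the fraction \<open>1 / n\<close> of all points.\<close>

lemma separated_or_cluster:
  assumes fin: "finite B" and \<kappa>: "\<kappa> \<ge> 0"
  obtains S where "S \<subseteq> B" "card S = Suc n" "separated \<kappa> S"
  | B' where "B' \<subseteq> B" "card B \<le> n * card B'" "diam_le B' (2 * \<kappa>)"
proof (cases "\<exists>S\<subseteq>B. card S = Suc n \<and> separated \<kappa> S")
  case True
  then show ?thesis using that by blast
next
  case False
  let ?P = "\<lambda>S. S \<subseteq> B \<and> separated \<kappa> S"
  have le: "card S \<le> n" if "?P S" for S
  proof (rule ccontr)
    assume "\<not> card S \<le> n"
    then obtain T where "T \<subseteq> S" "card T = Suc n" by (meson not_less_eq_eq obtain_subset_with_card_n)
    moreover from this have "separated \<kappa> T" using that by (auto simp: separated_def)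
    ultimately show False using False that by blast
  qed
  have "\<exists>S. ?P S \<and> (\<forall>T. ?P T \<longrightarrow> card T \<le> card S)"
    by (rule ex_has_greatest_nat[of ?P "{}" card "Suc n"])
       (use le in \<open>auto simp: separated_def less_Suc_eq_le\<close>)
  then obtain S where S: "?P S" and max: "\<And>T. ?P T \<Longrightarrow> card T \<le> card S" by blast
  have finS: "finite S" using S fin finite_subset by blast
  define N where "N s = {x\<in>B. \<bar>real_of_int (x - s)\<bar> \<le> \<kappa>}" for s
  have "B \<subseteq> (\<Union>s\<in>S. N s)"
  proof
    fix x assume x: "x \<in> B"
    show "x \<in> (\<Union>s\<in>S. N s)"
    proof (rule ccontr)
      assume out: "x \<notin> (\<Union>s\<in>S. N s)"
      then have "x \<notin> S" using x \<kappa> by (auto simp: N_def)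
      moreover have "separated \<kappa> (insert x S)"
        using S out x by (fastforce simp: separated_def N_def abs_minus_commute)
      ultimately show False using max[of "insert x S"] S x finS by auto
    qed
  qed
  then have "card B \<le> card (\<Union>s\<in>S. N s)" using fin finS by (intro card_mono) (auto simp: N_def)
  also have "\<dots> \<le> (\<Sum>s\<in>S. card (N s))" by (rule card_UN_le[OF finS])
  finally have sum: "card B \<le> (\<Sum>s\<in>S. card (N s))" .
  show ?thesis
  proof (cases "B = {}")
    case True
    then show ?thesis using that(2)[of "{}"] by (simp add: diam_le_def)
  next
    case False
    then have ne: "S \<noteq> {}" using \<open>B \<subseteq> (\<Union>s\<in>S. N s)\<close> by auto
    define m where "m = Max (card ` N ` S)"
    have "m \<in> card ` N ` S" unfolding m_def using ne finS by (intro Max_in) auto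
    then obtain s where s: "s \<in> S" "m = card (N s)" by blast
    have "(\<Sum>s\<in>S. card (N s)) \<le> (\<Sum>s\<in>S. m)"
      unfolding m_def using finS by (intro sum_mono Max_ge) auto
    also have "\<dots> \<le> n * card (N s)" using le[OF S] s by simp
    finally have "card B \<le> n * card (N s)" using sum by simp
    moreover have "diam_le (N s) (2 * \<kappa>)" by (auto simp: diam_le_def N_def)
    ultimately show ?thesis using that(2)[of "N s"] by (auto simp: N_def)
  qed
qed

definition poorly_approximable :: "real \<Rightarrow> real \<Rightarrow> real \<Rightarrow> bool" where
  "poorly_approximable c \<tau> \<alpha> \<longleftrightarrow>
     (\<forall>(r::int) (s::nat). s \<ge> 1 \<longrightarrow> c / real s powr \<tau> \<le> \<bar>\<alpha> - real_of_int r / real s\<bar>)"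

text \<open>The leading coefficient of \<open>g\<close> is a fraction with denominator \<open>s\<close>. By interpolation it is within
  \<open>(n + 1) \<delta> / \<kappa> ^ n\<close> of the leading coefficient of \<open>f\<close>, which is poorly approximable.\<close>

lemma leading_denom_large:
  assumes S: "card S = Suc n" and deg: "degree f \<le> n" "degree g \<le> n"
    and close: "\<And>i. i \<in> S \<Longrightarrow> \<bar>poly f (real_of_int i) - poly g (real_of_int i)\<bar> \<le> \<delta>"
    and sep: "separated \<kappa> S" "\<kappa> > 0" and \<delta>: "\<delta> \<ge> 0"
    and den: "is_denom {coeff g n} s"
    and dio: "poorly_approximable c \<tau> (coeff f n)"
  shows "c * \<kappa> ^ n \<le> (n + 1) * \<delta> * real_of_int s powr \<tau>"
proof -
  have s: "s > 0" "real_of_int s * coeff g n \<in> \<int>" using den by (auto simp: is_denom_def)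
  then obtain r :: int where "real_of_int s * coeff g n = r" by (auto elim: Ints_cases)
  then have r: "coeff g n = real_of_int r / real (nat s)" using s by (simp add: field_simps)
  have "c / real (nat s) powr \<tau> \<le> \<bar>coeff f n - coeff g n\<bar>"
  proof -
    have "nat s \<ge> 1" using s by simp
    then show ?thesis using dio unfolding r poorly_approximable_def by blast
  qed
  also have "\<dots> = \<bar>coeff (f - g) n\<bar>" by simp
  also have "\<dots> \<le> \<delta> * (\<Sum>i\<in>S. 1 / \<bar>real_of_int (node_prod S i)\<bar>)"
    by (rule interpolation_bound(2)[OF S]) (use close deg in \<open>auto intro: degree_diff_le\<close>)
  also have "\<dots> \<le> \<delta> * (\<Sum>i\<in>S. 1 / \<kappa> ^ n)"
  proof (intro mult_left_mono sum_mono)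
    fix i assume "i \<in> S"
    then have "\<kappa> ^ n \<le> \<bar>real_of_int (node_prod S i)\<bar>"
      using node_prod_ge[OF S _ sep(1)] sep(2) by simp
    then show "1 / \<bar>real_of_int (node_prod S i)\<bar> \<le> 1 / \<kappa> ^ n"
      using sep(2) by (intro frac_le) auto
  qed (use \<delta> in simp)
  also have "\<dots> = (n + 1) * \<delta> / \<kappa> ^ n" using S by simp
  finally show ?thesis using s sep by (simp add: field_simps)
qed

section \<open>Lattice points on a single rational curve\<close>

definition shadows :: "real poly \<Rightarrow> real \<Rightarrow> real poly \<Rightarrow> int set \<Rightarrow> bool" where
  "shadows f \<delta> g B \<longleftrightarrow>
     (\<forall>x\<in>B. poly g (real_of_int x) \<in> \<int> \<and> \<bar>poly f (real_of_int x) - poly g (real_of_int x)\<bar> \<le> \<delta>)"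

lemma shadows_subset: "shadows f \<delta> g B \<Longrightarrow> B' \<subseteq> B \<Longrightarrow> shadows f \<delta> g B'"
  by (auto simp: shadows_def)

lemma sqrt_disc_le:
  assumes "card S = Suc n" "diam_le S W" "W \<ge> 1" "m * m \<le> real_of_int (disc S)" "m \<ge> 0"
  shows "m \<le> W powr (real n * (real n + 1) / 2)"
proof -
  have fin: "finite S" using assms card.infinite by fastforce
  have "m\<^sup>2 \<le> real_of_int (disc S)" using assms by (simp add: power2_eq_square)
  also have "\<dots> \<le> W ^ (card S * (card S - 1))"
    using assms fin by (intro disc_le diam_leD)
  also have "\<dots> = W powr (real n * (real n + 1))"
    using assms by (simp add: powr_realpow[symmetric] algebra_simps)
  also have "\<dots> = (W powr (real n * (real n + 1) / 2))\<^sup>2"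
    using assms by (simp add: powr_power)
  finally show ?thesis by (rule power2_le_imp_le) simp
qed

lemma divisor_le:
  assumes "node_divisor n q S" "card S = Suc n" "diam_le S W" "W \<ge> 1" "q > 0"
  shows "real_of_int q \<le> W powr (real n * (real n + 1) / 2)"
proof (rule sqrt_disc_le[OF assms(2-4)])
  have fin: "finite S" using assms card.infinite by fastforce
  have "q * q \<le> disc S"
    using square_dvd_disc[OF assms(1,2)] disc_pos[OF fin] assms(5)
    by (intro zdvd_imp_le) (auto simp: power2_eq_square)
  then show "real_of_int q * real_of_int q \<le> real_of_int (disc S)"
    by (simp flip: of_int_mult)
qed (use assms in simp)

lemma divisor_le_node_prod:
  assumes div: "node_divisor n q S" and S: "card S = Suc n" and n: "n \<ge> 1"
    and W: "diam_le S W" "W \<ge> 1" and q: "q > 0" and i: "i \<in> S"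
  shows "real_of_int q \<le> W powr (real n * (real n - 1) / 2) * \<bar>real_of_int (node_prod S i)\<bar>"
proof -
  have fin: "finite S" using S card.infinite by fastforce
  have "q\<^sup>2 \<le> disc S"
    using square_dvd_disc[OF div S] disc_pos[OF fin] q by (intro zdvd_imp_le) auto
  also have "\<dots> = disc (S - {i}) * (node_prod S i)\<^sup>2" by (rule disc_remove[OF fin i])
  finally have "real_of_int (q\<^sup>2) \<le> real_of_int (disc (S - {i}) * (node_prod S i)\<^sup>2)"
    by (simp only: of_int_le_iff)
  then have "(real_of_int q)\<^sup>2 \<le> real_of_int (disc (S - {i})) * (real_of_int (node_prod S i))\<^sup>2"
    by simp
  also have "real_of_int (disc (S - {i})) \<le> W ^ (card (S - {i}) * (card (S - {i}) - 1))"
    using W fin by (intro disc_le) (auto dest: diam_leD)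
  then have "real_of_int (disc (S - {i})) * (real_of_int (node_prod S i))\<^sup>2
      \<le> W ^ (n * (n - 1)) * (real_of_int (node_prod S i))\<^sup>2"
    using S i by (intro mult_right_mono) auto
  also have "W ^ (n * (n - 1)) = W powr (real n * (real n - 1))"
    using W n by (simp add: powr_realpow[symmetric] of_nat_diff)
  also have "\<dots> = (W powr (real n * (real n - 1) / 2))\<^sup>2"
    using W by (simp add: powr_power)
  also have "\<dots> * (real_of_int (node_prod S i))\<^sup>2
      = (W powr (real n * (real n - 1) / 2) * \<bar>real_of_int (node_prod S i)\<bar>)\<^sup>2"
    by (simp add: power_mult_distrib)
  finally show ?thesis by (rule power2_le_imp_le) simp
qed

text \<open>In the \<open>i\<close>-th term of the weight, dividing \<open>q\<close> by the node product at \<open>i\<close> leaves at most the Vandermonde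
  product of the other \<open>n\<close> nodes, hence \<open>W powr (n (n - 1) / 2)\<close>; the numerator contributes another \<open>W ^ n\<close>.\<close>

lemma divisor_weight_le:
  assumes div: "node_divisor n q S" and S: "card S = Suc n" and n: "n \<ge> 1"
    and W: "diam_le (insert x S) W" "W \<ge> 1" and q: "q > 0"
  shows "real_of_int q * (1 + node_weight S x) \<le> (real n + 2) * W powr (real n * (real n + 1) / 2)"
proof -
  let ?N = "real n * (real n + 1) / 2"
  have W': "diam_le S W" using W(1) diam_le_subset by blast
  have fin: "finite S" using S card.infinite by fastforce
  have "real_of_int q * node_weight S x
      = (\<Sum>i\<in>S. real_of_int q * ((\<Prod>j\<in>S - {i}. \<bar>real_of_int (x - j)\<bar>) / \<bar>real_of_int (node_prod S i)\<bar>))"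
    by (simp add: node_weight_def sum_distrib_left)
  also have "\<dots> \<le> (\<Sum>i\<in>S. W powr ?N)"
  proof (rule sum_mono)
    fix i assume i: "i \<in> S"
    let ?d = "\<bar>real_of_int (node_prod S i)\<bar>" and ?p = "\<Prod>j\<in>S - {i}. \<bar>real_of_int (x - j)\<bar>"
    have d: "?d > 0" using node_prod_nonzero[OF fin] by simp
    have "?p \<le> (\<Prod>j\<in>S - {i}. W)"
    proof (intro prod_mono conjI)
      fix j assume "j \<in> S - {i}"
      then show "\<bar>real_of_int (x - j)\<bar> \<le> W" by (intro diam_leD[OF W(1)]) auto
    qed simp
    also have "\<dots> = W powr real n" using S i W by (simp add: powr_realpow)
    finally have p: "?p \<le> W powr real n" .
    have "real_of_int q * ?p \<le> (W powr (real n * (real n - 1) / 2) * ?d) * W powr real n"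
      using divisor_le_node_prod[OF div S n W' W(2) q i] p
      by (intro mult_mono) (auto intro: prod_nonneg)
    also have "\<dots> = W powr ?N * ?d"
      by (simp add: powr_add[symmetric] field_simps)
    finally show "real_of_int q * (?p / ?d) \<le> W powr ?N"
      using d by (simp add: pos_divide_le_eq)
  qed
  also have "\<dots> = (real n + 1) * W powr ?N" using S by simp
  finally show ?thesis
    using divisor_le[OF div S W' W(2) q] by (simp add: algebra_simps)
qed

text \<open>Here \<open>leading_denom_large\<close> bounds the denominator \<open>s\<close> of the leading coefficient of \<open>g\<close> from below by a
  constant times \<open>(H ^ n * L powr N) powr (2 / (n + 3))\<close>, so that \<open>H / s powr (1 / n)\<close> is at most a constant times
  \<open>(H / L) powr \<theta>\<close>.\<close>

lemma arc_card_separated: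
  fixes n :: nat and \<epsilon> c R :: real
  assumes n: "n \<ge> 1" and \<epsilon>: "\<epsilon> > 0" and c: "c > 0" and R: "R > 0"
  shows "\<exists>C\<ge>1. \<forall>f g \<delta> L H B S.
     degree f \<le> n \<longrightarrow> degree g \<le> n \<longrightarrow> poorly_approximable c ((real n + 3) / 2) (coeff f n) \<longrightarrow>
     0 \<le> \<delta> \<longrightarrow> \<delta> \<le> L powr (- (real n * (real n + 1) / 2)) \<longrightarrow> L \<ge> 1 \<longrightarrow> H \<ge> 1 \<longrightarrow> finite B \<longrightarrow>
     shadows f \<delta> g B \<longrightarrow> diam_le B H \<longrightarrow> S \<subseteq> B \<longrightarrow> card S = Suc n \<longrightarrow> separated (H / R) S \<longrightarrow>
     real (card B) \<le> C * H powr \<epsilon> * (1 + (H / L) powr ((real n + 1) / (real n + 3)))"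
proof -
  define N where "N = real n * (real n + 1) / 2"
  define \<tau> where "\<tau> = (real n + 3) / 2"
  define \<theta> where "\<theta> = (real n + 1) / (real n + 3)"
  have N: "N > 0" using n by (simp add: N_def)
  obtain C1 where C1: "C1 \<ge> 1"
    "\<And>q::int. q > 0 \<Longrightarrow> real n ^ card (prime_factors q) \<le> C1 * real_of_int q powr (\<epsilon> / N)"
    using power_omega_le[OF n, of "\<epsilon> / N"] \<epsilon> N by auto
  define K where "K = c / ((real n + 1) * R ^ n)"
  define a where "a = 1 / (real n * \<tau>)"
  define D where "D = max 1 (K powr (- a))"
  have K: "K > 0" using c R by (simp add: K_def)
  have n3: "real n + 3 > 0" by (simp add: add_nonneg_pos)
  then have \<tau>: "\<tau> > 0" by (simp add: \<tau>_def)
  then have a: "a > 0" using n by (simp add: a_def)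
  show ?thesis
  proof (rule exI[of _ "C1 * D"], intro conjI allI impI)
    show "1 \<le> C1 * D" using C1(1) by (simp add: D_def mult_ge1_I)
    fix f g :: "real poly" and \<delta> L H :: real and B S
    assume deg: "degree f \<le> n" "degree g \<le> n"
      and dio: "poorly_approximable c ((real n + 3) / 2) (coeff f n)"
      and \<delta>: "0 \<le> \<delta>" "\<delta> \<le> L powr (- (real n * (real n + 1) / 2))"
      and L: "L \<ge> 1" and H: "H \<ge> 1" and fin: "finite B"
      and sh: "shadows f \<delta> g B" and diam: "diam_le B H"
      and S: "S \<subseteq> B" "card S = Suc n" "separated (H / R) S"
    have int: "poly g (real_of_int x) \<in> \<int>" if "x \<in> B" for x using that sh by (auto simp: shadows_def)
    obtain s where s: "is_denom {coeff g n} s"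
      using denom_exists[OF S(2) deg(2), of "{coeff g n}"] int S(1) by blast
    have s0: "s > 0" using s by (simp add: is_denom_def)
    have div: "node_divisor n s B"
      by (rule node_divisor_denom[OF deg(2) int _ s]) auto
    have "c * (H / R) ^ n \<le> (real n + 1) * \<delta> * real_of_int s powr \<tau>"
      using leading_denom_large[OF S(2) deg _ S(3) _ \<delta>(1) s dio] sh S(1) H R
      by (auto simp: shadows_def \<tau>_def)
    also have "\<dots> \<le> (real n + 1) * L powr (- N) * real_of_int s powr \<tau>"
      using \<delta>(2) by (intro mult_right_mono mult_left_mono) (auto simp: N_def)
    finally have low0: "c * (H / R) ^ n \<le> (real n + 1) * L powr (- N) * real_of_int s powr \<tau>" .
    have "K * H powr n * L powr N = c * (H / R) ^ n * (L powr N / (real n + 1))"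
      using H by (simp add: K_def powr_realpow power_divide)
    also have "\<dots> \<le> (real n + 1) * L powr (- N) * real_of_int s powr \<tau> * (L powr N / (real n + 1))"
      using low0 by (rule mult_right_mono) simp
    also have "\<dots> = real_of_int s powr \<tau>"
      using L by (simp add: powr_minus)
    finally have "K * H powr n * L powr N \<le> real_of_int s powr \<tau>" .
    then have "(K * H powr real n * L powr N) powr a \<le> (real_of_int s powr \<tau>) powr a"
      using a K by (intro powr_mono2) auto
    also have "\<dots> = real_of_int s powr (1 / n)"
    proof -
      have "\<tau> * a = 1 / n" using \<tau> by (simp add: a_def)
      then show ?thesis by (simp add: powr_powr)
    qed
    also have "(K * H powr n * L powr N) powr a = K powr a * H powr (1 - \<theta>) * L powr \<theta>"
    proof -
      have "real n * a = 1 - \<theta>" "N * a = \<theta>"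
        using n n3 by (simp_all add: a_def \<tau>_def N_def \<theta>_def divide_simps)
      then show ?thesis by (simp add: powr_mult powr_powr)
    qed
    finally have low: "K powr a * H powr (1 - \<theta>) * L powr \<theta> \<le> real_of_int s powr (1 / n)" .
    have "H / real_of_int s powr (1 / n) \<le> H / (K powr a * H powr (1 - \<theta>) * L powr \<theta>)"
      using low K H L s0 by (intro divide_left_mono) auto
    also have "\<dots> = K powr (- a) * (H powr \<theta> / L powr \<theta>)"
    proof -
      have "H = H powr (1 - \<theta>) * H powr \<theta>" using H by (simp flip: powr_add)
      then have "H / (K powr a * H powr (1 - \<theta>) * L powr \<theta>)
          = H powr (1 - \<theta>) * H powr \<theta> / (K powr a * H powr (1 - \<theta>) * L powr \<theta>)" by simp
      also have "\<dots> = K powr (- a) * (H powr \<theta> / L powr \<theta>)"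
        using H by (simp add: powr_minus field_simps)
      finally show ?thesis .
    qed
    also have "\<dots> = K powr (- a) * (H / L) powr \<theta>"
      using H L by (simp add: powr_divide)
    also have "\<dots> \<le> D * (H / L) powr \<theta>"
      by (rule mult_right_mono) (simp_all add: D_def)
    finally have Hs: "H / real_of_int s powr (1 / n) \<le> D * (H / L) powr \<theta>" .
    have "real_of_int s \<le> H powr N"
      using divisor_le[OF node_divisor_subset[OF div S(1)] S(2) diam_le_subset[OF diam S(1)] H s0]
      by (simp add: N_def)
    then have "real_of_int s powr (\<epsilon> / N) \<le> (H powr N) powr (\<epsilon> / N)"
      using \<epsilon> N s0 by (intro powr_mono2) auto
    also have "\<dots> = H powr \<epsilon>" using N by (simp add: powr_powr)
    finally have sH: "real_of_int s powr (\<epsilon> / N) \<le> H powr \<epsilon>" .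
    have "real (card B) \<le> real n ^ card (prime_factors s) * (1 + H / real_of_int s powr (1 / n))"
      by (rule card_node_divisor_le[OF fin div s0 n]) (use H diam_leD[OF diam] in auto)
    also have "\<dots> \<le> (C1 * H powr \<epsilon>) * (D * (1 + (H / L) powr \<theta>))"
    proof (rule mult_mono)
      show "real n ^ card (prime_factors s) \<le> C1 * H powr \<epsilon>"
        using C1(2)[OF s0] sH C1(1) by (meson mult_left_mono order.trans zero_le_one)
      show "1 + H / real_of_int s powr (1 / n) \<le> D * (1 + (H / L) powr \<theta>)"
        using Hs by (simp add: D_def distrib_left)
    qed (use C1 H s0 in auto)
    finally show "real (card B) \<le> C1 * D * H powr \<epsilon> * (1 + (H / L) powr ((real n + 1) / (real n + 3)))"
      by (simp add: \<theta>_def mult_ac)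
  qed
qed

lemma card_le_1_of_diam:
  assumes "diam_le B H" "H < 1" "finite B"
  shows "card B \<le> 1"
proof -
  have "x = y" if "x \<in> B" "y \<in> B" for x y
  proof (rule ccontr)
    assume "x \<noteq> y"
    then have "1 \<le> \<bar>real_of_int (x - y)\<bar>" using separated_one[of "{x, y}"] by (simp add: separated_def)
    then show False using diam_leD[OF assms(1) that] assms(2) by simp
  qed
  then show ?thesis using assms(3) by (auto simp: card_le_Suc0_iff_eq)
qed

text \<open>If \<open>B\<close> has no \<open>n + 1\<close> well separated points, then a subset of diameter \<open>H / R\<close> contains the fraction
  \<open>1 / n\<close> of \<open>B\<close>. With \<open>R powr \<epsilon> = n + 1\<close> the loss of the factor \<open>n\<close> is absorbed by the factor
  \<open>H powr \<epsilon>\<close> of the bound, and induction on the scale applies.\<close>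

lemma arc_card:
  fixes n :: nat and \<epsilon> c :: real
  assumes n: "n \<ge> 1" and \<epsilon>: "\<epsilon> > 0" and c: "c > 0"
  obtains C where "C \<ge> 1" "\<And>f g \<delta> L H B.
     degree f \<le> n \<Longrightarrow> degree g \<le> n \<Longrightarrow> poorly_approximable c ((real n + 3) / 2) (coeff f n) \<Longrightarrow>
     0 \<le> \<delta> \<Longrightarrow> \<delta> \<le> L powr (- (real n * (real n + 1) / 2)) \<Longrightarrow> L \<ge> 1 \<Longrightarrow> H \<ge> 1 \<Longrightarrow> finite B \<Longrightarrow>
     shadows f \<delta> g B \<Longrightarrow> diam_le B H \<Longrightarrow>
     real (card B) \<le> C * H powr \<epsilon> * (1 + (H / L) powr ((real n + 1) / (real n + 3)))"
proof -
  define \<theta> where "\<theta> = (real n + 1) / (real n + 3)"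
  define R where "R = (real n + 1) powr (1 / \<epsilon>)"
  have R1: "R > 1" unfolding R_def using n \<epsilon> by (intro gr_one_powr) auto
  have R\<epsilon>: "R powr \<epsilon> = real n + 1" using \<epsilon> by (simp add: R_def powr_powr)
  have R2: "2 * R > 0" using R1 by simp
  obtain C1 where C1: "C1 \<ge> 1" and sep: "\<And>f g \<delta> L H B S.
     degree f \<le> n \<Longrightarrow> degree g \<le> n \<Longrightarrow> poorly_approximable c ((real n + 3) / 2) (coeff f n) \<Longrightarrow>
     0 \<le> \<delta> \<Longrightarrow> \<delta> \<le> L powr (- (real n * (real n + 1) / 2)) \<Longrightarrow> L \<ge> 1 \<Longrightarrow> H \<ge> 1 \<Longrightarrow> finite B \<Longrightarrow>
     shadows f \<delta> g B \<Longrightarrow> diam_le B H \<Longrightarrow> S \<subseteq> B \<Longrightarrow> card S = Suc n \<Longrightarrow> separated (H / (2 * R)) S \<Longrightarrow>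
     real (card B) \<le> C1 * H powr \<epsilon> * (1 + (H / L) powr ((real n + 1) / (real n + 3)))"
    using arc_card_separated[OF n \<epsilon> c R2] by blast
  define C where "C = max C1 (real n + 1)"
  show ?thesis
  proof (rule that[of C])
    show "C \<ge> 1" using C1 by (simp add: C_def)
    fix f g :: "real poly" and \<delta> L H :: real and B
    assume deg: "degree f \<le> n" "degree g \<le> n"
      and dio: "poorly_approximable c ((real n + 3) / 2) (coeff f n)"
      and \<delta>: "0 \<le> \<delta>" "\<delta> \<le> L powr (- (real n * (real n + 1) / 2))"
      and L: "L \<ge> 1" and H: "H \<ge> 1" and fin: "finite B"
      and sh: "shadows f \<delta> g B" and diam: "diam_le B H"
    \<comment> \<open>The induction ends at a scale between \<open>1 / R\<close> and 1, where at most one integer is left.\<close>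
    have main: "real (card B) \<le> C * H powr \<epsilon> * (1 + (H / L) powr \<theta>)"
      if "1 / R \<le> H" "H < R ^ m" "finite B" "shadows f \<delta> g B" "diam_le B H" for m H B
      using that
    proof (induction m arbitrary: H B)
      have small: "real (card B) \<le> C * H powr \<epsilon> * (1 + (H / L) powr \<theta>)"
        if "1 / R \<le> H" "H < 1" "finite B" "diam_le B H" for H B
      proof -
        have H0: "H > 0" using that(1) R1 by (smt (verit) divide_pos_pos)
        have "1 \<le> R * H" using that(1) R1 by (simp add: pos_divide_le_eq mult.commute)
        then have "1 \<le> (R * H) powr \<epsilon>" using \<epsilon> by (intro ge_one_powr_ge_zero) auto
        also have "\<dots> = (real n + 1) * H powr \<epsilon>" by (simp add: powr_mult R\<epsilon>)
        also have "\<dots> \<le> C * H powr \<epsilon>" by (intro mult_right_mono) (auto simp: C_def)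
        also have "\<dots> \<le> C * H powr \<epsilon> * (1 + (H / L) powr \<theta>)"
          using C1 by (simp add: C_def distrib_left)
        finally show ?thesis using card_le_1_of_diam[OF that(4,2,3)] by linarith
      qed
      {
        case 0
        then show ?case using small by simp
      next
        case (Suc m)
        show ?case
        proof (cases "H < 1")
          case True
          then show ?thesis using small Suc.prems by blast
        next
          case False
          then have H1: "H \<ge> 1" by simp
          show ?thesis
          proof (rule separated_or_cluster[of B "H / (2 * R)" n])
            fix S assume S: "S \<subseteq> B" "card S = Suc n" "separated (H / (2 * R)) S"
            have "real (card B) \<le> C1 * H powr \<epsilon> * (1 + (H / L) powr \<theta>)"
              using sep[OF deg dio \<delta> L H1 Suc.prems(3-5) S] by (simp add: \<theta>_def)
            also have "\<dots> \<le> C * H powr \<epsilon> * (1 + (H / L) powr \<theta>)"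
              by (intro mult_right_mono) (auto simp: C_def)
            finally show ?thesis .
          next
            fix B' assume B': "B' \<subseteq> B" "card B \<le> n * card B'" "diam_le B' (2 * (H / (2 * R)))"
            have HR: "H / R \<le> H" using H1 R1 by (simp add: pos_divide_le_eq)
            have "real (card B') \<le> C * (H / R) powr \<epsilon> * (1 + (H / R / L) powr \<theta>)"
            proof (rule Suc.IH)
              show "1 / R \<le> H / R" using H1 R1 by (simp add: divide_right_mono)
              show "H / R < R ^ m" using Suc.prems(2) R1 by (simp add: pos_divide_less_eq mult.commute)
              show "finite B'" using B'(1) Suc.prems(3) finite_subset by blast
              show "shadows f \<delta> g B'" using B'(1) Suc.prems(4) shadows_subset by blast
              show "diam_le B' (H / R)" using B'(3) by simp
            qed
            also have "\<dots> \<le> C * (H / R) powr \<epsilon> * (1 + (H / L) powr \<theta>)"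
              using HR C1 H1 L R1
              by (intro mult_left_mono add_left_mono powr_mono2 divide_right_mono)
                 (auto simp: \<theta>_def C_def)
            finally have "(real n + 1) * real (card B')
                \<le> (real n + 1) * (C * (H / R) powr \<epsilon> * (1 + (H / L) powr \<theta>))"
              by (intro mult_left_mono) auto
            also have "\<dots> = C * H powr \<epsilon> * (1 + (H / L) powr \<theta>)"
              using R1 H1 by (simp add: powr_divide R\<epsilon>)
            finally have "(real n + 1) * real (card B') \<le> C * H powr \<epsilon> * (1 + (H / L) powr \<theta>)" .
            moreover have "real (card B) \<le> (real n + 1) * real (card B')"
            proof -
              have "card B \<le> (n + 1) * card B'" using B'(2) by simp
              then have "real (card B) \<le> real ((n + 1) * card B')" by (simp only: of_nat_le_iff)
              then show ?thesis by (simp add: algebra_simps)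
            qed
            ultimately show ?thesis by linarith
          qed (use Suc.prems H1 R1 in auto)
        qed
      }
    qed
    obtain m where "H < R ^ m" using real_arch_pow[OF R1] by blast
    moreover have "1 / R \<le> H" by (rule order.trans[of _ 1]) (use R1 H in auto)
    ultimately show "real (card B) \<le> C * H powr \<epsilon> * (1 + (H / L) powr ((real n + 1) / (real n + 3)))"
      using main fin sh diam unfolding \<theta>_def by blast
  qed
qed

section \<open>Major arcs\<close>

definition near_curve :: "real poly \<Rightarrow> real \<Rightarrow> int set" where
  "near_curve f \<delta> = {x. \<exists>y\<in>\<int>. \<bar>y - poly f (real_of_int x)\<bar> \<le> \<delta>}"

text \<open>The interpolant through any \<open>n + 1\<close> of the lattice points passes through all of them, since its
  denominator and the interpolation weights together cost only \<open>(n + 2) L powr N\<close>.\<close>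

lemma arc_on_interval:
  assumes n: "n \<ge> 1" and deg: "degree f \<le> n" and L: "L \<ge> 1"
    and \<delta>: "0 \<le> \<delta>" "\<delta> \<le> L powr (- (real n * (real n + 1) / 2)) / (real n + 3)"
    and B: "B \<subseteq> near_curve f \<delta>" "diam_le B L" "Suc n \<le> card B"
  obtains g where "degree g \<le> n" "shadows f \<delta> g B"
proof -
  let ?N = "real n * (real n + 1) / 2"
  obtain S where S: "S \<subseteq> B" "card S = Suc n" using B(3) by (meson obtain_subset_with_card_n)
  have fin: "finite S" using S card.infinite by fastforce
  have "\<forall>x\<in>B. \<exists>y. y \<in> \<int> \<and> \<bar>y - poly f (real_of_int x)\<bar> \<le> \<delta>"
    using B(1) unfolding near_curve_def by blast
  from bchoice[OF this] obtain y where y: "\<And>x. x \<in> B \<Longrightarrow> y x \<in> \<int>"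
      "\<And>x. x \<in> B \<Longrightarrow> \<bar>y x - poly f (real_of_int x)\<bar> \<le> \<delta>" by blast
  define g where "g = lagrange S y"
  have deg_g: "degree g \<le> n" unfolding g_def by (rule degree_lagrange[OF S(2)])
  have gS: "poly g (real_of_int x) = y x" if "x \<in> S" for x
    unfolding g_def by (rule poly_lagrange_node[OF fin that])
  have gint: "poly g (real_of_int x) \<in> \<int>" if "x \<in> S" for x
    using gS[OF that] y(1)[of x] that S(1) by auto
  obtain q where q: "is_denom (range (coeff g)) q"
    using denom_exists[OF S(2) deg_g gint subset_refl] by blast
  have q0: "q > 0" using q by (simp add: is_denom_def)
  have div: "node_divisor n q S" by (rule node_divisor_denom[OF deg_g gint subset_refl q])
  have close: "\<bar>poly f (real_of_int i) - poly g (real_of_int i)\<bar> \<le> \<delta>" if "i \<in> S" for i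
    using y(2)[of i] gS[OF that] that S(1) by (auto simp: abs_minus_commute)
  have g: "poly g (real_of_int x) = y x" if x: "x \<in> B" for x
  proof (rule interpolant_continues[OF S(2) deg deg_g close q y(1)[OF x] y(2)[OF x]])
    have "diam_le (insert x S) L" using x S(1) by (intro diam_le_subset[OF B(2)]) auto
    then have "real_of_int q * (1 + node_weight S x) \<le> (real n + 2) * L powr ?N"
      by (rule divisor_weight_le[OF div S(2) n _ L q0])
    then have "\<delta> * (real_of_int q * (1 + node_weight S x)) \<le> \<delta> * ((real n + 2) * L powr ?N)"
      using \<delta>(1) by (rule mult_left_mono)
    also have "\<dots> \<le> (L powr (- ?N) / (real n + 3)) * ((real n + 2) * L powr ?N)"
      using \<delta>(2) by (rule mult_right_mono) simp
    also have "\<dots> = (real n + 2) / (real n + 3)"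
      using L by (simp add: powr_minus)
    also have "\<dots> < 1" by (simp add: add_nonneg_pos)
    finally show "real_of_int q * \<delta> * (1 + node_weight S x) < 1" by (simp add: mult_ac)
  qed
  have "shadows f \<delta> g B"
    using g y by (auto simp: shadows_def abs_minus_commute)
  with deg_g show ?thesis by (rule that)
qed

text \<open>The denominator \<open>s\<close> of the leading coefficient is bounded below by the Diophantine condition and
  above by the Vandermonde product. So \<open>n + 1\<close> points on a common curve cannot be clustered more tightly
  than a fixed power of \<open>L\<close>.\<close>

lemma arc_diam_lower:
  fixes n :: nat and c :: real
  assumes n: "n \<ge> 1" and c: "c > 0"
  obtains K where "K > 0" "\<And>f g \<delta> L W S.
     degree f \<le> n \<Longrightarrow> degree g \<le> n \<Longrightarrow> poorly_approximable c ((real n + 3) / 2) (coeff f n) \<Longrightarrow>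
     0 \<le> \<delta> \<Longrightarrow> \<delta> \<le> L powr (- (real n * (real n + 1) / 2)) \<Longrightarrow> L \<ge> 1 \<Longrightarrow> W \<ge> 1 \<Longrightarrow>
     shadows f \<delta> g S \<Longrightarrow> diam_le S W \<Longrightarrow> card S = Suc n \<Longrightarrow>
     K * L powr (2 / (real n + 3)) \<le> W"
proof -
  define N where "N = real n * (real n + 1) / 2"
  define \<tau> where "\<tau> = (real n + 3) / 2"
  have N: "N > 0" using n by (simp add: N_def)
  have \<tau>: "\<tau> > 0" by (simp add: \<tau>_def add_nonneg_pos)
  define a where "a = 1 / (N * \<tau>)"
  have a: "a > 0" using N \<tau> by (simp add: a_def)
  define K where "K = (c / (real n + 1)) powr a"
  show ?thesis
  proof (rule that[of K])
    show "K > 0" using c by (simp add: K_def)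
    fix f g :: "real poly" and \<delta> L W :: real and S
    assume deg: "degree f \<le> n" "degree g \<le> n"
      and dio: "poorly_approximable c ((real n + 3) / 2) (coeff f n)"
      and \<delta>: "0 \<le> \<delta>" "\<delta> \<le> L powr (- (real n * (real n + 1) / 2))"
      and L: "L \<ge> 1" and W: "W \<ge> 1"
      and sh: "shadows f \<delta> g S" and diam: "diam_le S W" and S: "card S = Suc n"
    have int: "poly g (real_of_int x) \<in> \<int>" if "x \<in> S" for x using that sh by (auto simp: shadows_def)
    have close: "\<bar>poly f (real_of_int i) - poly g (real_of_int i)\<bar> \<le> \<delta>" if "i \<in> S" for i
      using that sh by (auto simp: shadows_def)
    have Z: "{coeff g n} \<subseteq> range (coeff g)" by auto
    obtain s where s: "is_denom {coeff g n} s"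
      using denom_exists[OF S deg(2) int Z] by blast
    have s0: "s > 0" using s by (simp add: is_denom_def)
    have "real_of_int s \<le> W powr N"
      unfolding N_def by (rule divisor_le[OF node_divisor_denom[OF deg(2) int Z s] S diam W s0])
    then have sW: "real_of_int s powr \<tau> \<le> W powr (N * \<tau>)"
      using powr_mono2[of \<tau> "real_of_int s" "W powr N"] s0 \<tau> by (simp add: powr_powr)
    have "c * 1 ^ n \<le> (real n + 1) * \<delta> * real_of_int s powr \<tau>"
      unfolding \<tau>_def
      by (rule leading_denom_large[OF S deg close separated_one _ \<delta>(1) s dio]) auto
    also have "\<dots> \<le> (real n + 1) * L powr (- N) * W powr (N * \<tau>)"
      using \<delta> sW by (intro mult_mono) (auto simp: N_def)
    finally have "c / (real n + 1) * L powr N \<le> W powr (N * \<tau>)"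
      using L by (simp add: powr_minus field_simps)
    then have "(c / (real n + 1) * L powr N) powr a \<le> (W powr (N * \<tau>)) powr a"
      using a c by (intro powr_mono2) auto
    also have "\<dots> = W" using W N \<tau> by (simp add: powr_powr a_def)
    also have "(c / (real n + 1) * L powr N) powr a = K * L powr (N * a)"
      by (simp only: powr_mult powr_powr K_def)
    also have "N * a = 2 / (real n + 3)"
      using N by (simp add: a_def \<tau>_def)
    finally show "K * L powr (2 / (real n + 3)) \<le> W" .
  qed
qed

text \<open>Each failure to find \<open>n + 1\<close> well separated points raises the scale to the power \<open>1 - \<eta>\<close> and costs a
  factor \<open>n\<close> in the number of points. Together with \<open>arc_diam_lower\<close>, a bounded number of such steps
  suffices.\<close>

lemma spread_subset:
  fixes \<eta> :: real
  assumes \<eta>: "0 < \<eta>" "\<eta> < 1" and "W0 \<ge> 1" "finite B" "k * n ^ j \<le> card B" "diam_le B W0" "n \<ge> 1"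
  shows "(\<exists>B' S W. 1 \<le> W \<and> W \<le> W0 \<and> B' \<subseteq> B \<and> k \<le> card B' \<and> diam_le B' W \<and>
            S \<subseteq> B' \<and> card S = Suc n \<and> separated (W powr (1 - \<eta>) / 2) S)
       \<or> (\<exists>B'\<subseteq>B. k \<le> card B' \<and> diam_le B' (W0 powr ((1 - \<eta>) ^ j)))"
  using assms(3-7)
proof (induction j arbitrary: B W0)
  case 0
  then show ?case by auto
next
  case (Suc j)
  let ?W = "W0 powr (1 - \<eta>)"
  have W1: "?W \<ge> 1" using Suc.prems \<eta> by (intro ge_one_powr_ge_zero) auto
  have "?W \<le> W0 powr 1" using Suc.prems \<eta> by (intro powr_mono) auto
  then have WW: "?W \<le> W0" using Suc.prems by simp
  have k: "k \<le> card B" using Suc.prems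
    by (metis le_trans mult.right_neutral mult_le_mono2 one_le_power)
  show ?case
  proof (rule separated_or_cluster[of B "?W / 2" n])
    fix S assume "S \<subseteq> B" "card S = Suc n" "separated (?W / 2) S"
    then show ?thesis using Suc.prems k by blast
  next
    fix B' assume B': "B' \<subseteq> B" "card B \<le> n * card B'" "diam_le B' (2 * (?W / 2))"
    have "n * (k * n ^ j) = k * n ^ Suc j" by simp
    also have "\<dots> \<le> n * card B'" using Suc.prems(3) B'(2) by (rule order.trans)
    finally have "n * (k * n ^ j) \<le> n * card B'" .
    from mult_left_le_imp_le[OF this] have "k * n ^ j \<le> card B'" using Suc.prems(5) by simp
    moreover have "finite B'" using B' Suc.prems finite_subset by blast
    moreover have "diam_le B' ?W" using B' by simp
    ultimately have "(\<exists>B'' S W. 1 \<le> W \<and> W \<le> ?W \<and> B'' \<subseteq> B' \<and> k \<le> card B'' \<and> diam_le B'' W \<and>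
            S \<subseteq> B'' \<and> card S = Suc n \<and> separated (W powr (1 - \<eta>) / 2) S)
       \<or> (\<exists>B''\<subseteq>B'. k \<le> card B'' \<and> diam_le B'' (?W powr ((1 - \<eta>) ^ j)))"
      using Suc.IH[OF W1] Suc.prems by blast
    then show ?thesis
    proof
      assume "\<exists>B'' S W. 1 \<le> W \<and> W \<le> ?W \<and> B'' \<subseteq> B' \<and> k \<le> card B'' \<and> diam_le B'' W \<and>
            S \<subseteq> B'' \<and> card S = Suc n \<and> separated (W powr (1 - \<eta>) / 2) S"
      then show ?thesis using B'(1) WW by (meson order.trans)
    next
      assume "\<exists>B''\<subseteq>B'. k \<le> card B'' \<and> diam_le B'' (?W powr ((1 - \<eta>) ^ j))"
      then show ?thesis using B'(1) by (auto simp: powr_powr)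
    qed
  qed (use Suc.prems in auto)
qed

lemma node_weight_le:
  assumes S: "card S = Suc n" "separated \<kappa> S" "\<kappa> > 0"
    and x: "\<And>j. j \<in> S \<Longrightarrow> \<bar>real_of_int (x - j)\<bar> \<le> H" and H: "H \<ge> 0"
  shows "node_weight S x \<le> (real n + 1) * (H / \<kappa>) ^ n"
proof -
  have fin: "finite S" using S card.infinite by fastforce
  have "node_weight S x \<le> (\<Sum>i\<in>S. H ^ n / \<kappa> ^ n)"
    unfolding node_weight_def
  proof (rule sum_mono)
    fix i assume i: "i \<in> S"
    have "(\<Prod>j\<in>S - {i}. \<bar>real_of_int (x - j)\<bar>) \<le> (\<Prod>j\<in>S - {i}. H)"
      by (intro prod_mono conjI x) auto
    also have "\<dots> = H ^ n" using S i by simp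
    finally show "(\<Prod>j\<in>S - {i}. \<bar>real_of_int (x - j)\<bar>) / \<bar>real_of_int (node_prod S i)\<bar> \<le> H ^ n / \<kappa> ^ n"
      using node_prod_ge[OF S(1) i S(2)] S(3) H by (intro frac_le) auto
  qed
  also have "\<dots> = (real n + 1) * (H / \<kappa>) ^ n" using S by (simp add: power_divide)
  finally show ?thesis .
qed

text \<open>Take intervals greedily from the left, each starting at the first point that is not yet covered; only
  the last one can extend beyond \<open>b\<close>.\<close>

lemma cover_count:
  fixes A :: "int set" and \<rho> b l :: real
  assumes "finite A" "\<rho> \<ge> 0" "l \<ge> 0" "a \<le> b"
    and "\<And>x. x \<in> A \<Longrightarrow> a \<le> real_of_int x \<and> real_of_int x \<le> b"
    and "\<And>x. x \<in> A \<Longrightarrow> \<exists>h>0. h \<le> l \<and> real (card {z\<in>A. x \<le> z \<and> real_of_int z < real_of_int x + h}) \<le> \<rho> * h"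
  shows "real (card A) \<le> \<rho> * (b - a + l)"
  using assms
proof (induction "card A" arbitrary: A a rule: less_induct)
  case less
  show ?case
  proof (cases "A = {}")
    case True
    then show ?thesis using less.prems by simp
  next
    case False
    define x where "x = Min A"
    have x: "x \<in> A" "\<And>z. z \<in> A \<Longrightarrow> x \<le> z" using less.prems False by (auto simp: x_def)
    obtain h where h: "h > 0" "h \<le> l" "real (card {z\<in>A. x \<le> z \<and> real_of_int z < real_of_int x + h}) \<le> \<rho> * h"
      using less.prems(6)[OF x(1)] by blast
    define A1 where "A1 = {z\<in>A. x \<le> z \<and> real_of_int z < real_of_int x + h}"
    define A2 where "A2 = {z\<in>A. real_of_int x + h \<le> real_of_int z}"
    have AA: "A = A1 \<union> A2" "A1 \<inter> A2 = {}" using x by (auto simp: A1_def A2_def)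
    have fin: "finite A1" "finite A2" using less.prems by (auto simp: A1_def A2_def)
    have card: "card A = card A1 + card A2" using AA fin by (metis card_Un_disjoint)
    have ax: "a \<le> real_of_int x" "real_of_int x \<le> b" using less.prems(5)[OF x(1)] by auto
    show ?thesis
    proof (cases "A2 = {}")
      case True
      have "real (card A) \<le> \<rho> * h" using card True h(3) by (simp add: A1_def)
      also have "\<dots> \<le> \<rho> * (b - a + l)" using h ax less.prems by (intro mult_left_mono) auto
      finally show ?thesis .
    next
      case False
      have "x \<in> A1" using x h by (simp add: A1_def)
      then have "card A1 > 0" using fin by (auto simp: card_gt_0_iff)
      then have lt: "card A2 < card A" using card by simp
      have "real (card A2) \<le> \<rho> * (b - (real_of_int x + h) + l)"
      proof (rule less.hyps[OF lt fin(2) less.prems(2,3)])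
        show "real_of_int x + h \<le> b" using False less.prems(5) by (force simp: A2_def)
        fix z assume z: "z \<in> A2"
        then have zA: "z \<in> A" by (simp add: A2_def)
        show "real_of_int x + h \<le> real_of_int z \<and> real_of_int z \<le> b"
          using z less.prems(5)[OF zA] by (simp add: A2_def)
        obtain h' where h': "h' > 0" "h' \<le> l"
          "real (card {w\<in>A. z \<le> w \<and> real_of_int w < real_of_int z + h'}) \<le> \<rho> * h'"
          using less.prems(6)[OF zA] by blast
        have "card {w\<in>A2. z \<le> w \<and> real_of_int w < real_of_int z + h'}
            \<le> card {w\<in>A. z \<le> w \<and> real_of_int w < real_of_int z + h'}"
          using less.prems(1) by (intro card_mono) (auto simp: A2_def)
        then show "\<exists>h>0. h \<le> l \<and> real (card {w\<in>A2. z \<le> w \<and> real_of_int w < real_of_int z + h}) \<le> \<rho> * h"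
          using h' by (intro exI[of _ h']) linarith
      qed
      then have "real (card A) \<le> \<rho> * h + \<rho> * (b - (real_of_int x + h) + l)"
        using card h(3) by (simp add: A1_def)
      also have "\<dots> = \<rho> * (b - real_of_int x + l)" by (simp add: algebra_simps)
      also have "\<dots> \<le> \<rho> * (b - a + l)" using ax less.prems by (intro mult_left_mono) auto
      finally show ?thesis .
    qed
  qed
qed

lemma powr_ge_of_ge_root:
  fixes b e L :: real
  assumes "b powr (1 / e) \<le> L" "e > 0" "b > 0"
  shows "b \<le> L powr e"
proof -
  have "(b powr (1 / e)) powr e \<le> L powr e" using assms by (intro powr_mono2) auto
  then show ?thesis using assms by (simp add: powr_powr)
qed

text \<open>The bound \<open>divisor_le\<close> has exponent \<open>n (n + 1) / 2\<close>; the saving is the factor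
  \<open>1 - 1 / (2 C + 1)\<close>.\<close>

lemma denominator_saving_powr:
  fixes n :: nat and C :: nat
  defines "C \<equiv> (n\<^sup>2 + 1) choose (n + 1)"
  assumes n: "n \<ge> 2" and fin: "finite B" and card: "n\<^sup>2 + 1 \<le> card B"
    and div: "node_divisor n q B" and q: "q > 0" and diam: "diam_le B W" and W: "W \<ge> 1"
  shows "real_of_int q \<le> W powr (real n * (real n + 1) / 2 * (1 - 1 / (2 * real C + 1)))"
proof -
  obtain B' where B': "B' \<subseteq> B" "card B' = n\<^sup>2 + 1" "finite B'"
    using card obtain_subset_with_card_n by blast
  have pw: "real_of_int q powr real k = real_of_int q ^ k" "W powr real k = W ^ k" for k
    using q W by (auto intro!: powr_realpow)
  have "real_of_int q ^ (2 * C + 1) \<le> W ^ (n * (n + 1) * C)"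
    unfolding C_def
    by (rule denominator_saving[OF n B'(3,2) node_divisor_subset[OF div B'(1)] q])
       (rule diam_leD[OF diam_le_subset[OF diam B'(1)]])
  then have "real_of_int q powr real (2 * C + 1) \<le> W powr real (n * (n + 1) * C)"
    unfolding pw .
  then have "(real_of_int q powr real (2 * C + 1)) powr (1 / real (2 * C + 1))
      \<le> (W powr real (n * (n + 1) * C)) powr (1 / real (2 * C + 1))"
    by (intro powr_mono2) auto
  moreover have "(real_of_int q powr real (2 * C + 1)) powr (1 / real (2 * C + 1)) = real_of_int q"
    using q by (subst powr_powr) (simp del: of_nat_add of_nat_mult)
  moreover have "real (n * (n + 1) * C) * (1 / real (2 * C + 1))
      = real n * (real n + 1) / 2 * (1 - 1 / (2 * real C + 1))"
    by (simp add: field_simps)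
  ultimately show ?thesis by (simp only: powr_powr)
qed

text \<open>The lattice points \<open>B\<close> in an interval of length \<open>L\<close> lie on one curve \<open>g\<close>. Among them there
  are \<open>n\<^sup>2 + 1\<close> points of some diameter \<open>W\<close>, including \<open>n + 1\<close> nodes that are almost \<open>W\<close> apart, and \<open>W\<close> is
  at least \<open>L powr (1 / (n + 3))\<close>. The saving in the denominator is therefore a fixed power of \<open>L\<close>. It outweighs
  both the imperfect separation of the nodes and the growth of the interpolation weights out to the distance
  \<open>L powr (1 + \<eta>)\<close>, so \<open>interpolant_continues\<close> still applies there.\<close>

lemma major_arc:
  fixes n :: nat and c :: real
  assumes n: "n \<ge> 2" and c: "c > 0"
  obtains L0 \<eta> :: real and M :: nat where "L0 \<ge> 1" "0 < \<eta>" "\<eta> \<le> 1"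
    "\<And>f \<delta> L B. degree f \<le> n \<Longrightarrow> poorly_approximable c ((real n + 3) / 2) (coeff f n) \<Longrightarrow>
     0 \<le> \<delta> \<Longrightarrow> \<delta> \<le> L powr (- (real n * (real n + 1) / 2)) / (real n + 3) \<Longrightarrow> L \<ge> L0 \<Longrightarrow>
     B \<subseteq> near_curve f \<delta> \<Longrightarrow> diam_le B L \<Longrightarrow> finite B \<Longrightarrow> M \<le> card B \<Longrightarrow>
     \<exists>g. degree g \<le> n \<and>
       shadows f \<delta> g {x \<in> near_curve f \<delta>. \<exists>b\<in>B. \<bar>real_of_int (x - b)\<bar> \<le> L powr (1 + \<eta>)}"
proof -
  define N where "N = real n * (real n + 1) / 2"
  define C where "C = (n\<^sup>2 + 1) choose (n + 1)"
  define \<eta>0 where "\<eta>0 = 1 / (2 * real C + 1)"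
  \<comment> \<open>The saving is \<open>N * \<eta>0 \<ge> n * \<eta>0\<close> in the exponent of \<open>W\<close>. The separation \<open>W powr (1 - \<sigma>)\<close>
    costs a quarter of it, the distance \<open>L powr (1 + \<eta>)\<close> half, and \<open>L powr (- \<nu>)\<close> remains.\<close>
  define \<sigma> where "\<sigma> = \<eta>0 / 4"
  define m where "m = real n + 3"
  define \<eta> where "\<eta> = \<eta>0 / (2 * m)"
  define \<nu> where "\<nu> = real n * \<eta>0 / (4 * m)"
  define D where "D = (real n + 2) * 4 ^ n"
  have n1: "n \<ge> 1" using n by simp
  have Nn: "N \<ge> real n" using n by (simp add: N_def)
  have \<eta>0: "0 < \<eta>0" "\<eta>0 \<le> 1" by (simp_all add: \<eta>0_def)
  have \<sigma>: "0 < \<sigma>" "\<sigma> < 1" using \<eta>0 by (simp_all add: \<sigma>_def)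
  have m: "m \<ge> 3" by (simp add: m_def)
  have \<eta>: "0 < \<eta>" "\<eta> \<le> 1" using \<eta>0 m by (simp_all add: \<eta>_def)
  have \<nu>: "0 < \<nu>" using \<eta>0 m n by (simp add: \<nu>_def)
  have D: "D > 0" by (simp add: D_def add_nonneg_pos)
  obtain j where j: "(1 - \<sigma>) ^ j < 1 / m"
    using real_arch_pow_inv[of "1 / m" "1 - \<sigma>"] \<sigma> m by auto
  obtain K where K: "K > 0" and lower: "\<And>f g \<delta> L W S.
     degree f \<le> n \<Longrightarrow> degree g \<le> n \<Longrightarrow> poorly_approximable c ((real n + 3) / 2) (coeff f n) \<Longrightarrow>
     0 \<le> \<delta> \<Longrightarrow> \<delta> \<le> L powr (- N) \<Longrightarrow> L \<ge> 1 \<Longrightarrow> W \<ge> 1 \<Longrightarrow>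
     shadows f \<delta> g S \<Longrightarrow> diam_le S W \<Longrightarrow> card S = Suc n \<Longrightarrow> K * L powr (2 / m) \<le> W"
    using arc_diam_lower[OF n1 c] unfolding N_def m_def by blast
  define L0 where "L0 = max 1 (max ((2 / K) powr (1 / (1 / m))) ((2 * D) powr (1 / \<nu>)))"
  show ?thesis
  proof (rule that[of L0 \<eta> "(n\<^sup>2 + 1) * n ^ j"])
    show "L0 \<ge> 1" by (simp add: L0_def)
    show "0 < \<eta>" "\<eta> \<le> 1" by fact+
    fix f :: "real poly" and \<delta> L :: real and B
    assume deg: "degree f \<le> n"
      and dio: "poorly_approximable c ((real n + 3) / 2) (coeff f n)"
      and \<delta>: "0 \<le> \<delta>" "\<delta> \<le> L powr (- (real n * (real n + 1) / 2)) / (real n + 3)"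
      and LL0: "L \<ge> L0" and B: "B \<subseteq> near_curve f \<delta>" and diam: "diam_le B L" and fin: "finite B"
      and card: "(n\<^sup>2 + 1) * n ^ j \<le> card B"
    have L: "L \<ge> 1" using LL0 by (simp add: L0_def)
    have L1: "2 / K \<le> L powr (1 / m)"
      by (rule powr_ge_of_ge_root) (use LL0 K m in \<open>auto simp: L0_def\<close>)
    then have L1': "2 \<le> K * L powr (1 / m)" using K by (simp add: pos_divide_le_eq mult.commute)
    have L2: "2 * D \<le> L powr \<nu>"
      by (rule powr_ge_of_ge_root) (use LL0 D \<nu> in \<open>auto simp: L0_def\<close>)
    have "L powr (- N) / m \<le> L powr (- N) / 1" using m by (intro divide_left_mono) auto
    then have \<delta>N: "\<delta> \<le> L powr (- N)" using \<delta>(2) by (simp add: N_def m_def)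
    have low: "2 * L powr (1 / m) \<le> K * L powr (2 / m)"
    proof -
      have "L powr (2 / m) = L powr (1 / m) * L powr (1 / m)" by (simp flip: powr_add)
      then show ?thesis using mult_right_mono[OF L1', of "L powr (1 / m)"] by (simp add: mult.assoc)
    qed
    have big: "n\<^sup>2 + 1 \<ge> Suc n" using n by (simp add: power2_eq_square)
    have "n ^ j \<ge> 1" using n by simp
    then have "n\<^sup>2 + 1 \<le> (n\<^sup>2 + 1) * n ^ j" by (metis mult_le_mono2 mult.right_neutral)
    then have "Suc n \<le> card B" using card big by linarith
    then obtain g where g: "degree g \<le> n" "shadows f \<delta> g B"
      using arc_on_interval[OF n1 deg L \<delta> B diam] by blast
    have "(\<exists>B' S W. 1 \<le> W \<and> W \<le> L \<and> B' \<subseteq> B \<and> n\<^sup>2 + 1 \<le> card B' \<and> diam_le B' W \<and>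
            S \<subseteq> B' \<and> card S = Suc n \<and> separated (W powr (1 - \<sigma>) / 2) S)
       \<or> (\<exists>B'\<subseteq>B. n\<^sup>2 + 1 \<le> card B' \<and> diam_le B' (L powr ((1 - \<sigma>) ^ j)))"
      by (rule spread_subset[OF \<sigma> L fin card diam n1])
    \<comment> \<open>The cluster alternative contradicts \<open>arc_diam_lower\<close>.\<close>
    then obtain B' S W where W: "1 \<le> W" "W \<le> L" and B': "B' \<subseteq> B" "n\<^sup>2 + 1 \<le> card B'" "diam_le B' W"
      and S: "S \<subseteq> B'" "card S = Suc n" "separated (W powr (1 - \<sigma>) / 2) S"
    proof (elim disjE)
      assume "\<exists>B'\<subseteq>B. n\<^sup>2 + 1 \<le> card B' \<and> diam_le B' (L powr ((1 - \<sigma>) ^ j))"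
      then obtain B' where B': "B' \<subseteq> B" "n\<^sup>2 + 1 \<le> card B'" "diam_le B' (L powr ((1 - \<sigma>) ^ j))" by blast
      have "Suc n \<le> card B'" using B'(2) big by linarith
      then obtain S where S: "S \<subseteq> B'" "card S = Suc n" by (meson obtain_subset_with_card_n)
      have "K * L powr (2 / m) \<le> L powr ((1 - \<sigma>) ^ j)"
      proof (rule lower[OF deg g(1) dio \<delta>(1) \<delta>N L])
        show "1 \<le> L powr ((1 - \<sigma>) ^ j)" using L \<sigma> by (intro ge_one_powr_ge_zero) auto
        show "shadows f \<delta> g S" using g(2) S(1) B'(1) shadows_subset by blast
        show "diam_le S (L powr ((1 - \<sigma>) ^ j))" using B'(3) S(1) diam_le_subset by blast
      qed fact
      also have "\<dots> \<le> L powr (1 / m)" using L j by (intro powr_mono) auto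
      finally have "2 * L powr (1 / m) \<le> L powr (1 / m)" using low by linarith
      then have False using L by simp
      then show ?thesis ..
    qed blast
    have finB': "finite B'" using B' fin finite_subset by blast
    have shS: "shadows f \<delta> g S" using g(2) S(1) B'(1) shadows_subset by blast
    have "K * L powr (2 / m) \<le> W"
      by (rule lower[OF deg g(1) dio \<delta>(1) \<delta>N L W(1) shS diam_le_subset[OF B'(3) S(1)] S(2)])
    then have WL: "L powr (1 / m) \<le> W" using low powr_ge_zero[of L "1 / m"] by linarith
    have int: "poly g (real_of_int x) \<in> \<int>" if "x \<in> B'" for x
      using that g(2) B'(1) by (auto simp: shadows_def)
    have intS: "poly g (real_of_int x) \<in> \<int>" if "x \<in> S" for x
      using that int S(1) by blast
    obtain q where q: "is_denom (range (coeff g)) q"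
      using denom_exists[OF S(2) g(1) intS subset_refl] by blast
    have q0: "q > 0" using q by (simp add: is_denom_def)
    have qW: "real_of_int q \<le> W powr (N * (1 - \<eta>0))"
      unfolding N_def \<eta>0_def C_def
      by (rule denominator_saving_powr[OF n finB' B'(2) node_divisor_denom[OF g(1) int subset_refl q] q0 B'(3) W(1)])
    define H where "H = L powr (1 + \<eta>)"
    have HL: "H \<ge> L"
    proof -
      have "L powr 1 \<le> H" unfolding H_def using L \<eta> by (intro powr_mono) auto
      then show ?thesis using L by simp
    qed
    have on_g: "poly g (real_of_int x) = y"
      if y: "y \<in> \<int>" "\<bar>y - poly f (real_of_int x)\<bar> \<le> \<delta>" and b: "b \<in> B" "\<bar>real_of_int (x - b)\<bar> \<le> H"
      for x y b
    proof (rule interpolant_continues[OF S(2) deg g(1) _ q y])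
      show "\<bar>poly f (real_of_int i) - poly g (real_of_int i)\<bar> \<le> \<delta>" if "i \<in> S" for i
        using shS that by (auto simp: shadows_def)
      define \<kappa> where "\<kappa> = W powr (1 - \<sigma>)"
      have \<kappa>: "\<kappa> > 0" using W by (simp add: \<kappa>_def)
      have "\<kappa> \<le> W powr 1" unfolding \<kappa>_def using W \<sigma> by (intro powr_mono) auto
      then have \<kappa>H: "\<kappa> \<le> H" using W HL by simp
      have "node_weight S x \<le> (real n + 1) * ((2 * H) / (\<kappa> / 2)) ^ n"
      proof (rule node_weight_le[OF S(2)])
        show "separated (\<kappa> / 2) S" "\<kappa> / 2 > 0" "2 * H \<ge> 0"
          using S(3) \<kappa> HL L by (simp_all add: \<kappa>_def)
        fix i assume "i \<in> S"
        then have "i \<in> B" using S(1) B'(1) by blast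
        then have "\<bar>real_of_int (b - i)\<bar> \<le> L" by (rule diam_leD[OF diam b(1)])
        then show "\<bar>real_of_int (x - i)\<bar> \<le> 2 * H" using b(2) HL by simp
      qed
      also have "((2 * H) / (\<kappa> / 2)) ^ n = 4 ^ n * (H / \<kappa>) ^ n"
        by (simp flip: power_mult_distrib)
      finally have w: "node_weight S x \<le> (real n + 1) * (4 ^ n * (H / \<kappa>) ^ n)" .
      have "1 \<le> (4::real) ^ n * (H / \<kappa>) ^ n"
        using \<kappa> \<kappa>H by (intro mult_ge1_I one_le_power) auto
      then have "1 + node_weight S x \<le> D * (H / \<kappa>) ^ n"
        using w by (simp add: D_def algebra_simps)
      also have "(H / \<kappa>) ^ n = L powr (real n * (1 + \<eta>)) * W powr (- (real n * (1 - \<sigma>)))"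
      proof -
        have "H ^ n = L powr (real n * (1 + \<eta>))" using L by (simp add: H_def powr_power)
        moreover have "\<kappa> ^ n = W powr (real n * (1 - \<sigma>))" using W by (simp add: \<kappa>_def powr_power)
        ultimately show ?thesis by (simp add: power_mult_distrib power_inverse powr_minus divide_inverse)
      qed
      finally have w1: "1 + node_weight S x
          \<le> D * (L powr (real n * (1 + \<eta>)) * W powr (- (real n * (1 - \<sigma>))))" .
      have nonneg: "0 \<le> 1 + node_weight S x"
        by (auto simp: node_weight_def intro!: add_nonneg_nonneg sum_nonneg divide_nonneg_nonneg prod_nonneg)
      have "real_of_int q * \<delta> * (1 + node_weight S x)
          \<le> W powr (N * (1 - \<eta>0)) * L powr (- N)
            * (D * (L powr (real n * (1 + \<eta>)) * W powr (- (real n * (1 - \<sigma>)))))"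
        using qW \<delta>N \<delta>(1) w1 q0 nonneg by (intro mult_mono) auto
      also have "\<dots> = D * (L powr (real n * (1 + \<eta>) - N)
            * (W powr (N - real n) * W powr (- (N * \<eta>0 - real n * \<sigma>))))"
        by (simp add: powr_add[symmetric] algebra_simps)
      also have "\<dots> \<le> D * (L powr (real n * (1 + \<eta>) - N)
            * (L powr (N - real n) * L powr (- (3 / 4 * real n * \<eta>0 / m))))"
      proof (intro mult_left_mono mult_mono)
        show "W powr (N - real n) \<le> L powr (N - real n)"
          using W Nn by (intro powr_mono2) auto
        have "real n * \<eta>0 \<le> N * \<eta>0" using Nn \<eta>0 by (intro mult_right_mono) auto
        then have "W powr (- (N * \<eta>0 - real n * \<sigma>)) \<le> W powr (- (3 / 4 * real n * \<eta>0))"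
          using W by (intro powr_mono) (auto simp: \<sigma>_def)
        also have "\<dots> \<le> (L powr (1 / m)) powr (- (3 / 4 * real n * \<eta>0))"
          using WL L \<eta>0 by (intro powr_mono2') auto
        also have "\<dots> = L powr (- (3 / 4 * real n * \<eta>0 / m))" by (simp add: powr_powr mult.commute)
        finally show "W powr (- (N * \<eta>0 - real n * \<sigma>)) \<le> L powr (- (3 / 4 * real n * \<eta>0 / m))" .
      qed (use D in auto)
      also have "\<dots> = D * L powr (- \<nu>)"
      proof -
        have "(real n * (1 + \<eta>) - N) + ((N - real n) + (- (3 / 4 * real n * \<eta>0 / m))) = - \<nu>"
          using m by (simp add: \<eta>_def \<nu>_def field_simps)
        then show ?thesis by (simp only: powr_add[symmetric])
      qed
      also have "\<dots> \<le> 1 / 2" using L2 L by (simp add: powr_minus field_simps)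
      finally show "real_of_int q * \<delta> * (1 + node_weight S x) < 1" by linarith
    qed
    have "shadows f \<delta> g {x \<in> near_curve f \<delta>. \<exists>b\<in>B. \<bar>real_of_int (x - b)\<bar> \<le> L powr (1 + \<eta>)}"
      unfolding shadows_def
    proof
      fix x assume "x \<in> {x \<in> near_curve f \<delta>. \<exists>b\<in>B. \<bar>real_of_int (x - b)\<bar> \<le> L powr (1 + \<eta>)}"
      then obtain y b where y: "y \<in> \<int>" "\<bar>y - poly f (real_of_int x)\<bar> \<le> \<delta>"
        and b: "b \<in> B" "\<bar>real_of_int (x - b)\<bar> \<le> H" by (auto simp: near_curve_def H_def)
      show "poly g (real_of_int x) \<in> \<int> \<and> \<bar>poly f (real_of_int x) - poly g (real_of_int x)\<bar> \<le> \<delta>"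
        using on_g[OF y b] y by (simp add: abs_minus_commute)
    qed
    with g(1) show "\<exists>g. degree g \<le> n \<and>
       shadows f \<delta> g {x \<in> near_curve f \<delta>. \<exists>b\<in>B. \<bar>real_of_int (x - b)\<bar> \<le> L powr (1 + \<eta>)}" by blast
  qed
qed

section \<open>Counting lattice points near the curve\<close>

definition near_points :: "real poly \<Rightarrow> real \<Rightarrow> real \<Rightarrow> int set" where
  "near_points f \<delta> X = {x \<in> near_curve f \<delta>. X \<le> real_of_int x \<and> real_of_int x \<le> 2 * X}"

lemma finite_near_points: "finite (near_points f \<delta> X)"
proof (rule finite_subset)
  show "near_points f \<delta> X \<subseteq> {\<lceil>X\<rceil>..\<lfloor>2 * X\<rfloor>}"
    by (auto simp: near_points_def ceiling_le_iff le_floor_iff)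
qed simp

lemma near_points_bounds:
  "x \<in> near_points f \<delta> X \<Longrightarrow> X \<le> real_of_int x \<and> real_of_int x \<le> 2 * X"
  by (simp add: near_points_def)

lemma diam_near_points: "diam_le (near_points f \<delta> X) X"
  by (auto simp: diam_le_def near_points_def abs_le_iff)

lemma card_near_points_le:
  assumes "X \<ge> 0"
  shows "real (card (near_points f \<delta> X)) \<le> 1 + X"
  using card_congruent_le[OF finite_near_points, of 1 X f \<delta> X] assms diam_leD[OF diam_near_points]
  by simp

text \<open>Two integers within \<open>1 / 4\<close> of the same real number coincide, so the abscissa determines the point.\<close>

lemma lattice_count_le:
  assumes "\<delta> \<le> 1 / 4"
  shows "lattice_count f \<delta> X \<le> card (near_points f \<delta> X)"
  unfolding lattice_count_def
proof (rule card_inj_on_le[of "\<lambda>p. \<lfloor>fst p\<rfloor>"])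
  show "inj_on (\<lambda>p. \<lfloor>fst p\<rfloor>) (curve_nbhd f \<delta> X \<inter> \<int> \<times> \<int>)"
  proof (rule inj_onI)
    fix p p' assume p: "p \<in> curve_nbhd f \<delta> X \<inter> \<int> \<times> \<int>" and p': "p' \<in> curve_nbhd f \<delta> X \<inter> \<int> \<times> \<int>"
      and eq: "\<lfloor>fst p\<rfloor> = \<lfloor>fst p'\<rfloor>"
    have x: "fst p = fst p'" using p p' eq by (auto elim!: Ints_cases)
    have "\<bar>snd p - poly f (fst p)\<bar> \<le> \<delta>" "\<bar>snd p' - poly f (fst p)\<bar> \<le> \<delta>"
      using p p' x by (auto simp: curve_nbhd_def)
    then have "\<bar>snd p - snd p'\<bar> < 1" using assms by linarith
    moreover have "snd p - snd p' \<in> \<int>" using p p' by auto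
    ultimately have "snd p - snd p' = 0" using Ints_nonzero_abs_less1 by blast
    with x show "p = p'" by (simp add: prod_eq_iff)
  qed
  show "(\<lambda>p. \<lfloor>fst p\<rfloor>) ` (curve_nbhd f \<delta> X \<inter> \<int> \<times> \<int>) \<subseteq> near_points f \<delta> X"
    by (auto simp: curve_nbhd_def near_points_def near_curve_def elim!: Ints_cases intro: Ints_of_int)
qed (rule finite_near_points)

text \<open>Call an interval of length \<open>L\<close> dense if it contains at least \<open>M\<close> points, and let \<open>H = L powr (1 + \<eta>)\<close>. A
  dense interval extends to one of length \<open>H\<close> whose points all lie on one curve; if \<open>H < X\<close>, these are at
  most a constant times \<open>H / L\<close> points, the same density as in a sparse interval. If \<open>X \<le> H\<close> and there is a
  dense interval, then all points lie on one curve and \<open>arc_card\<close> applies to the whole of \<open>[X, 2 X]\<close>.\<close>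

lemma near_points_card:
  fixes n :: nat and \<epsilon> c :: real
  assumes n: "n \<ge> 2" and \<epsilon>: "\<epsilon> > 0" and c: "c > 0"
  obtains C L0 where "C \<ge> 1" "L0 \<ge> 1" "\<And>f \<delta> L X.
     degree f \<le> n \<Longrightarrow> poorly_approximable c ((real n + 3) / 2) (coeff f n) \<Longrightarrow>
     0 \<le> \<delta> \<Longrightarrow> \<delta> \<le> L powr (- (real n * (real n + 1) / 2)) / (real n + 3) \<Longrightarrow> L \<ge> L0 \<Longrightarrow> X \<ge> 2 \<Longrightarrow>
     real (card (near_points f \<delta> X)) \<le> C * (X / L + X powr \<epsilon>)"
proof -
  define \<theta> where "\<theta> = (real n + 1) / (real n + 3)"
  have \<theta>: "0 < \<theta>" "\<theta> < 1" by (simp_all add: \<theta>_def add_nonneg_pos)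
  have n1: "n \<ge> 1" using n by simp
  show ?thesis
  proof (rule major_arc[OF n c])
    fix L0 \<eta> :: real and M :: nat
    assume L0: "L0 \<ge> 1" and \<eta>: "0 < \<eta>" "\<eta> \<le> 1" and arc: "\<And>f \<delta> L B. degree f \<le> n \<Longrightarrow>
     poorly_approximable c ((real n + 3) / 2) (coeff f n) \<Longrightarrow>
     0 \<le> \<delta> \<Longrightarrow> \<delta> \<le> L powr (- (real n * (real n + 1) / 2)) / (real n + 3) \<Longrightarrow> L \<ge> L0 \<Longrightarrow>
     B \<subseteq> near_curve f \<delta> \<Longrightarrow> diam_le B L \<Longrightarrow> finite B \<Longrightarrow> M \<le> card B \<Longrightarrow>
     \<exists>g. degree g \<le> n \<and>
       shadows f \<delta> g {x \<in> near_curve f \<delta>. \<exists>b\<in>B. \<bar>real_of_int (x - b)\<bar> \<le> L powr (1 + \<eta>)}"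
  \<comment> \<open>\<open>\<epsilon>1\<close> makes \<open>H powr \<epsilon>1 * (H / L) powr \<theta> \<le> H / L\<close> for \<open>H = L powr (1 + \<eta>)\<close>;
    \<open>\<epsilon>2\<close> makes \<open>X powr \<epsilon>2 * (X / L) powr \<theta>\<close> a weighted geometric mean of \<open>X powr \<epsilon>\<close> and \<open>X / L\<close>.\<close>
  define \<epsilon>1 where "\<epsilon>1 = \<eta> * (1 - \<theta>) / 2"
  define \<epsilon>2 where "\<epsilon>2 = \<epsilon> * (1 - \<theta>)"
  have \<epsilon>1: "\<epsilon>1 > 0" and \<epsilon>2: "\<epsilon>2 > 0" using \<eta> \<theta> \<epsilon> by (simp_all add: \<epsilon>1_def \<epsilon>2_def)
  obtain C1 where C1: "C1 \<ge> 1" and cnt1: "\<And>f g \<delta> L H B.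
     degree f \<le> n \<Longrightarrow> degree g \<le> n \<Longrightarrow> poorly_approximable c ((real n + 3) / 2) (coeff f n) \<Longrightarrow>
     0 \<le> \<delta> \<Longrightarrow> \<delta> \<le> L powr (- (real n * (real n + 1) / 2)) \<Longrightarrow> L \<ge> 1 \<Longrightarrow> H \<ge> 1 \<Longrightarrow> finite B \<Longrightarrow>
     shadows f \<delta> g B \<Longrightarrow> diam_le B H \<Longrightarrow> real (card B) \<le> C1 * H powr \<epsilon>1 * (1 + (H / L) powr \<theta>)"
    using arc_card[OF n1 \<epsilon>1 c] unfolding \<theta>_def by blast
  obtain C2 where C2: "C2 \<ge> 1" and cnt2: "\<And>f g \<delta> L H B.
     degree f \<le> n \<Longrightarrow> degree g \<le> n \<Longrightarrow> poorly_approximable c ((real n + 3) / 2) (coeff f n) \<Longrightarrow>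
     0 \<le> \<delta> \<Longrightarrow> \<delta> \<le> L powr (- (real n * (real n + 1) / 2)) \<Longrightarrow> L \<ge> 1 \<Longrightarrow> H \<ge> 1 \<Longrightarrow> finite B \<Longrightarrow>
     shadows f \<delta> g B \<Longrightarrow> diam_le B H \<Longrightarrow> real (card B) \<le> C2 * H powr \<epsilon>2 * (1 + (H / L) powr \<theta>)"
    using arc_card[OF n1 \<epsilon>2 c] unfolding \<theta>_def by blast
  define P where "P = max (real M) (2 * C1)"
  have P: "P \<ge> 2" using C1 by (simp add: P_def)
  show ?thesis
  proof (rule that[of "2 * P + 2 * C2" L0])
    show "1 \<le> 2 * P + 2 * C2" using P C2 by simp
    show "L0 \<ge> 1" by fact
    fix f :: "real poly" and \<delta> L X :: real
    assume deg: "degree f \<le> n"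
      and dio: "poorly_approximable c ((real n + 3) / 2) (coeff f n)"
      and \<delta>: "0 \<le> \<delta>" "\<delta> \<le> L powr (- (real n * (real n + 1) / 2)) / (real n + 3)"
      and LL0: "L \<ge> L0" and X: "X \<ge> 2"
    have L: "L \<ge> 1" using LL0 L0 by simp
    have "L powr (- (real n * (real n + 1) / 2)) / (real n + 3) \<le> L powr (- (real n * (real n + 1) / 2)) / 1"
      by (intro divide_left_mono) auto
    then have \<delta>N: "\<delta> \<le> L powr (- (real n * (real n + 1) / 2))" using \<delta>(2) by simp
    define A where "A = near_points f \<delta> X"
    have finA: "finite A" by (simp add: A_def finite_near_points)
    have A: "A \<subseteq> near_curve f \<delta>" by (auto simp: A_def near_points_def)
    have bounds: "X \<le> real_of_int x \<and> real_of_int x \<le> 2 * X" if "x \<in> A" for x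
      using that by (simp add: A_def near_points_def)
    define H where "H = L powr (1 + \<eta>)"
    have HL: "H = L * L powr \<eta>" using L by (simp add: H_def powr_add)
    have "L powr \<eta> \<ge> 1" using L \<eta> by (intro ge_one_powr_ge_zero) auto
    then have LH: "L \<le> H" using L by (simp add: HL)
    define win where "win x h = {z\<in>A. x \<le> z \<and> real_of_int z < real_of_int x + h}" for x h
    have win: "win x h \<subseteq> A" "finite (win x h)" "diam_le (win x h) h" for x h
      using finA by (auto simp: win_def diam_le_def abs_le_iff)
    have dense: "\<exists>g. degree g \<le> n \<and> shadows f \<delta> g {z \<in> A. \<bar>real_of_int (z - x)\<bar> \<le> H}"
      if x: "x \<in> A" "M \<le> card (win x L)" for x
    proof -
      obtain g where g: "degree g \<le> n"
        "shadows f \<delta> g {z \<in> near_curve f \<delta>. \<exists>b\<in>win x L. \<bar>real_of_int (z - b)\<bar> \<le> L powr (1 + \<eta>)}"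
        using arc[OF deg dio \<delta> LL0 _ win(3) win(2) x(2)] win(1) A by blast
      have "x \<in> win x L" using x L by (simp add: win_def)
      then have "{z \<in> A. \<bar>real_of_int (z - x)\<bar> \<le> H}
          \<subseteq> {z \<in> near_curve f \<delta>. \<exists>b\<in>win x L. \<bar>real_of_int (z - b)\<bar> \<le> L powr (1 + \<eta>)}"
        using A by (auto simp: H_def)
      with g show ?thesis using shadows_subset by blast
    qed
    have X0: "X / L \<ge> 0" "X powr \<epsilon> \<ge> 1" using X L \<epsilon> by (auto intro!: ge_one_powr_ge_zero)
    have cover: "real (card A) \<le> P / L * (X + l)"
      if "l \<ge> 0" "\<And>x. x \<in> A \<Longrightarrow> \<exists>h>0. h \<le> l \<and> real (card (win x h)) \<le> P / L * h" for l
    proof -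
      have "real (card A) \<le> P / L * (2 * X - X + l)"
        by (rule cover_count[OF finA _ that(1) _ bounds]) (use that(2) P L X in \<open>auto simp: win_def\<close>)
      then show ?thesis by simp
    qed
    have sparse: "real (card (win x L)) \<le> P / L * L" if "\<not> M \<le> card (win x L)" for x
      using that L by (simp add: P_def)
    show "real (card (near_points f \<delta> X)) \<le> (2 * P + 2 * C2) * (X / L + X powr \<epsilon>)"
    proof (cases "X \<le> H")
      case True
      show ?thesis
      proof (cases "\<exists>x\<in>A. M \<le> card (win x L)")
        case True
        then obtain x where x: "x \<in> A" "M \<le> card (win x L)" by blast
        obtain g where g: "degree g \<le> n" "shadows f \<delta> g {z \<in> A. \<bar>real_of_int (z - x)\<bar> \<le> H}"
          using dense[OF x] by blast
        have diamA: "diam_le A X" unfolding A_def by (rule diam_near_points)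
        have "\<bar>real_of_int (z - x)\<bar> \<le> H" if "z \<in> A" for z
          using diam_leD[OF diamA that x(1)] \<open>X \<le> H\<close> by simp
        then have "{z \<in> A. \<bar>real_of_int (z - x)\<bar> \<le> H} = A" by blast
        then have "shadows f \<delta> g A" using g(2) by simp
        then have "real (card A) \<le> C2 * X powr \<epsilon>2 * (1 + (X / L) powr \<theta>)"
          using cnt2[OF deg g(1) dio \<delta>(1) \<delta>N L _ finA _ diamA] X by simp
        also have "\<dots> = C2 * (X powr \<epsilon>2 + X powr \<epsilon>2 * (X / L) powr \<theta>)"
          by (simp add: algebra_simps)
        also have "\<dots> \<le> C2 * (X powr \<epsilon> + (X powr \<epsilon> + X / L))"
        proof (intro mult_left_mono add_mono)
          show "X powr \<epsilon>2 \<le> X powr \<epsilon>"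
            using X \<epsilon> \<theta> by (intro powr_mono) (auto simp: \<epsilon>2_def mult_left_le)
          define m where "m = max (X powr \<epsilon>) (X / L)"
          have "X powr \<epsilon>2 = (X powr \<epsilon>) powr (1 - \<theta>)" by (simp add: powr_powr \<epsilon>2_def)
          also have "\<dots> \<le> m powr (1 - \<theta>)" using \<theta> by (intro powr_mono2) (auto simp: m_def)
          finally have "X powr \<epsilon>2 * (X / L) powr \<theta> \<le> m powr (1 - \<theta>) * m powr \<theta>"
            using \<theta> X0 by (intro mult_mono powr_mono2) (auto simp: m_def)
          also have "\<dots> = m" using X0 by (simp add: m_def flip: powr_add)
          also have "m \<le> X powr \<epsilon> + X / L" using X0 by (simp add: m_def)
          finally show "X powr \<epsilon>2 * (X / L) powr \<theta> \<le> X powr \<epsilon> + X / L" .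
        qed (use C2 in simp)
        also have "\<dots> \<le> C2 * (2 * (X / L + X powr \<epsilon>))"
        proof (rule mult_left_mono)
          have "a + (a + b) \<le> 2 * (b + a)" if "b \<ge> 0" for a b :: real using that by simp
          then show "X powr \<epsilon> + (X powr \<epsilon> + X / L) \<le> 2 * (X / L + X powr \<epsilon>)" using X0(1) .
        qed (use C2 in simp)
        also have "\<dots> = (2 * C2) * (X / L + X powr \<epsilon>)" by simp
        also have "\<dots> \<le> (2 * P + 2 * C2) * (X / L + X powr \<epsilon>)"
          using P X0 by (intro mult_right_mono) auto
        finally show ?thesis by (simp add: A_def)
      next
        case False
        then have "real (card A) \<le> P / L * (X + L)"
          using sparse L by (intro cover) (auto intro!: exI[of _ L])
        also have "\<dots> = P * (X / L + 1)" using L by (simp add: field_simps)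
        also have "\<dots> \<le> (2 * P + 2 * C2) * (X / L + X powr \<epsilon>)"
          using X0 P C2 by (intro mult_mono) auto
        finally show ?thesis by (simp add: A_def)
      qed
    next
      case False
      have "real (card A) \<le> P / L * (X + H)"
      proof (rule cover)
        show "H \<ge> 0" using LH L by simp
        fix x assume x: "x \<in> A"
        show "\<exists>h>0. h \<le> H \<and> real (card (win x h)) \<le> P / L * h"
        proof (cases "M \<le> card (win x L)")
          case True
          obtain g where g: "degree g \<le> n" "shadows f \<delta> g {z \<in> A. \<bar>real_of_int (z - x)\<bar> \<le> H}"
            using dense[OF x True] by blast
          have "win x H \<subseteq> {z \<in> A. \<bar>real_of_int (z - x)\<bar> \<le> H}" by (auto simp: win_def)
          then have "shadows f \<delta> g (win x H)" using g(2) shadows_subset by blast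
          then have "real (card (win x H)) \<le> C1 * H powr \<epsilon>1 * (1 + (H / L) powr \<theta>)"
            using cnt1[OF deg g(1) dio \<delta>(1) \<delta>N L _ win(2) _ win(3)] LH L by simp
          also have "\<dots> \<le> C1 * H powr \<epsilon>1 * (2 * (H / L) powr \<theta>)"
          proof (intro mult_left_mono)
            have "(H / L) powr \<theta> \<ge> 1"
              using LH L \<theta> by (intro ge_one_powr_ge_zero) auto
            then show "1 + (H / L) powr \<theta> \<le> 2 * (H / L) powr \<theta>" by simp
          qed (use C1 in simp)
          also have "\<dots> = 2 * C1 * L powr ((1 + \<eta>) * \<epsilon>1 + \<eta> * \<theta>)"
          proof -
            have "H / L = L powr \<eta>" using L by (simp add: HL)
            then have "(H / L) powr \<theta> = L powr (\<eta> * \<theta>)" by (simp only: powr_powr)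
            moreover have "H powr \<epsilon>1 = L powr ((1 + \<eta>) * \<epsilon>1)" by (simp only: H_def powr_powr)
            ultimately show ?thesis by (simp add: powr_add)
          qed
          also have "\<dots> \<le> 2 * C1 * L powr \<eta>"
          proof (intro mult_left_mono powr_mono)
            have "(1 + \<eta>) * \<epsilon>1 \<le> 2 * \<epsilon>1" using \<eta> \<epsilon>1 by (intro mult_right_mono) auto
            also have "\<dots> = \<eta> * (1 - \<theta>)" by (simp add: \<epsilon>1_def)
            finally show "(1 + \<eta>) * \<epsilon>1 + \<eta> * \<theta> \<le> \<eta>" by (simp add: algebra_simps)
          qed (use C1 L in auto)
          also have "\<dots> \<le> P * L powr \<eta>" by (intro mult_right_mono) (auto simp: P_def)
          also have "\<dots> = P / L * H" using L by (simp add: HL)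
          finally show ?thesis using LH L by (intro exI[of _ H]) auto
        next
          case False
          then show ?thesis using sparse[OF False] LH L by (intro exI[of _ L]) auto
        qed
      qed
      also have "\<dots> \<le> P / L * (X + X)"
        using False P L by (intro mult_left_mono) auto
      also have "\<dots> = 2 * P * (X / L)" by simp
      also have "\<dots> \<le> (2 * P + 2 * C2) * (X / L + X powr \<epsilon>)"
        using P C2 X0 by (intro mult_mono) auto
      finally show ?thesis by (simp add: A_def)
    qed
  qed
  qed
qed

text \<open>For \<open>\<delta> > 0\<close> take the \<open>L\<close> for which the hypothesis of \<open>near_points_card\<close> on \<open>\<delta>\<close> is an equality; if it is
  below the threshold \<open>L0\<close>, then \<open>\<delta>\<close> is bounded below and the trivial bound suffices. For \<open>\<delta> = 0\<close> every
  \<open>L\<close> is admissible, and \<open>L \<ge> X\<close> makes the first term harmless.\<close>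

lemma lattice_count_higher:
  fixes n :: nat and \<epsilon> c :: real
  assumes n: "n \<ge> 2" and \<epsilon>: "\<epsilon> > 0" and c: "c > 0"
  obtains C where "C > 0" "\<And>f \<delta> X. degree f \<le> n \<Longrightarrow>
     poorly_approximable c ((real n + 3) / 2) (coeff f n) \<Longrightarrow> 0 \<le> \<delta> \<Longrightarrow> \<delta> \<le> 1 / 4 \<Longrightarrow> X \<ge> 2 \<Longrightarrow>
     real (lattice_count f \<delta> X) \<le> C * (\<delta> powr (2 / (real n * (real n + 1))) * X + X powr \<epsilon>)"
proof -
  define N where "N = real n * (real n + 1) / 2"
  have N: "N > 0" using n by (simp add: N_def)
  obtain C L0 where C: "C \<ge> 1" and L0: "L0 \<ge> 1" and bound: "\<And>f \<delta> L X.
     degree f \<le> n \<Longrightarrow> poorly_approximable c ((real n + 3) / 2) (coeff f n) \<Longrightarrow>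
     0 \<le> \<delta> \<Longrightarrow> \<delta> \<le> L powr (- N) / (real n + 3) \<Longrightarrow> L \<ge> L0 \<Longrightarrow> X \<ge> 2 \<Longrightarrow>
     real (card (near_points f \<delta> X)) \<le> C * (X / L + X powr \<epsilon>)"
    using near_points_card[OF n \<epsilon> c] unfolding N_def by blast
  define D where "D = (real n + 3) powr (1 / N)"
  have D: "D \<ge> 1" unfolding D_def using N by (intro ge_one_powr_ge_zero) auto
  define E where "E = (2 * C + 2 * L0) * D"
  have E: "E \<ge> 2 * C" "E \<ge> C * D" "E \<ge> 2 * L0 * D" "E > 0"
    unfolding E_def using mult_mono[of "2 * C" "2 * C + 2 * L0" 1 D] C D L0
    by (auto simp: algebra_simps)
  show ?thesis
  proof (rule that[of E])
    show "E > 0" by fact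
    fix f :: "real poly" and \<delta> X :: real
    assume deg: "degree f \<le> n" and dio: "poorly_approximable c ((real n + 3) / 2) (coeff f n)"
      and \<delta>: "0 \<le> \<delta>" "\<delta> \<le> 1 / 4" and X: "X \<ge> 2"
    let ?A = "near_points f \<delta> X" and ?e = "2 / (real n * (real n + 1))"
    have X\<epsilon>: "X powr \<epsilon> \<ge> 1" using X \<epsilon> by (intro ge_one_powr_ge_zero) auto
    have "real (card ?A) \<le> E * (\<delta> powr ?e * X + X powr \<epsilon>)"
    proof (cases "\<delta> = 0")
      case True
      define L where "L = max L0 X"
      have "real (card ?A) \<le> C * (X / L + X powr \<epsilon>)"
        by (rule bound[OF deg dio \<delta>(1) _ _ X]) (use True in \<open>auto simp: L_def\<close>)
      also have "X / L \<le> 1" using X by (simp add: L_def)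
      then have "C * (X / L + X powr \<epsilon>) \<le> C * (X powr \<epsilon> + X powr \<epsilon>)"
        using X\<epsilon> C by (intro mult_left_mono) auto
      also have "\<dots> = (2 * C) * X powr \<epsilon>" by simp
      also have "\<dots> \<le> E * X powr \<epsilon>" using E(1) by (rule mult_right_mono) simp
      finally show ?thesis using True by simp
    next
      case False
      then have \<delta>0: "\<delta> > 0" using \<delta> by simp
      define L where "L = 1 / (D * \<delta> powr ?e)"
      have L: "L > 0" using D \<delta>0 by (simp add: L_def)
      have e: "?e = 1 / N" by (simp add: N_def)
      have "L powr (- N) = (D * \<delta> powr ?e) powr N"
        using D \<delta>0 by (simp add: L_def powr_minus powr_divide)
      also have "\<dots> = (real n + 3) * \<delta>"
        using N \<delta>0 unfolding e by (simp add: D_def powr_mult powr_powr)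
      finally have \<delta>L: "\<delta> = L powr (- N) / (real n + 3)" by (simp add: add_nonneg_eq_0_iff)
      have XL: "X / L = D * (\<delta> powr ?e * X)" by (simp add: L_def)
      show ?thesis
      proof (cases "L \<ge> L0")
        case True
        have "real (card ?A) \<le> C * (X / L + X powr \<epsilon>)"
          by (rule bound[OF deg dio \<delta>(1) _ True X]) (use \<delta>L in simp)
        also have "\<dots> = C * D * (\<delta> powr ?e * X) + C * X powr \<epsilon>"
          by (simp add: XL distrib_left)
        also have "\<dots> \<le> E * (\<delta> powr ?e * X) + E * X powr \<epsilon>"
          using E C X by (intro add_mono mult_right_mono) auto
        finally show ?thesis by (simp add: distrib_left)
      next
        case False
        have "real (card ?A) \<le> 1 + X" using X by (intro card_near_points_le) simp
        also have "\<dots> \<le> 2 * X * 1" using X by simp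
        also have "\<dots> \<le> 2 * X * (L0 / L)" using False L X by (intro mult_left_mono) auto
        also have "\<dots> = 2 * L0 * (X / L)" by simp
        also have "\<dots> = 2 * L0 * D * (\<delta> powr ?e * X)" by (simp add: XL)
        also have "\<dots> \<le> E * (\<delta> powr ?e * X)" using E(3) X by (intro mult_right_mono) auto
        also have "\<dots> \<le> E * (\<delta> powr ?e * X + X powr \<epsilon>)" using E(4) by (intro mult_left_mono) auto
        finally show ?thesis .
      qed
    qed
    then show "real (lattice_count f \<delta> X) \<le> E * (\<delta> powr ?e * X + X powr \<epsilon>)"
      using lattice_count_le[OF \<delta>(2), of f X] by linarith
  qed
qed

text \<open>The slope of the chord through two of the lattice points is a rational number too close to the
  slope of the line unless the points are at least \<open>c / (2 \<delta>)\<close> apart.\<close>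

lemma lattice_count_linear:
  assumes c: "c > 0" and deg: "degree f \<le> 1" and dio: "poorly_approximable c 2 (coeff f 1)"
    and \<delta>: "0 \<le> \<delta>" "\<delta> \<le> 1 / 4" and X: "X \<ge> 2"
  shows "real (lattice_count f \<delta> X) \<le> (2 / c + 2) * (\<delta> * X + 1)"
proof -
  let ?A = "near_points f \<delta> X"
  have poly_f: "poly f x = coeff f 0 + coeff f 1 * x" for x
  proof -
    have "f = [:coeff f 0, coeff f 1:]"
      using deg by (intro poly_eqI) (auto simp: coeff_pCons coeff_eq_0 split: nat.split)
    then have "poly f x = poly [:coeff f 0, coeff f 1:] x"
      by (rule arg_cong[where f = "\<lambda>p. poly p x"])
    then show ?thesis by simp
  qed
  have gap: "c \<le> 2 * \<delta> * real_of_int (z - x)" if "x \<in> ?A" "z \<in> ?A" "x < z" for x z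
  proof -
    obtain y w where y: "y \<in> \<int>" "\<bar>y - poly f (real_of_int x)\<bar> \<le> \<delta>"
      and w: "w \<in> \<int>" "\<bar>w - poly f (real_of_int z)\<bar> \<le> \<delta>"
      using \<open>x \<in> ?A\<close> \<open>z \<in> ?A\<close> by (auto simp: near_points_def near_curve_def)
    obtain r :: int where r: "w - y = real_of_int r" using y(1) w(1) Ints_diff by (metis Ints_cases)
    define d where "d = nat (z - x)"
    have d: "d \<ge> 1" "real d = real_of_int (z - x)" using that by (auto simp: d_def)
    have "\<bar>coeff f 1 * real d - r\<bar> \<le> 2 * \<delta>"
      using y(2) w(2) r unfolding poly_f d(2) by (simp add: algebra_simps)
    have "c / real d powr 2 \<le> \<bar>coeff f 1 - real_of_int r / real d\<bar>"
      using dio d(1) unfolding poorly_approximable_def by blast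
    also have "\<dots> = \<bar>coeff f 1 * real d - r\<bar> / real d"
    proof -
      have "coeff f 1 - real_of_int r / real d = (coeff f 1 * real d - r) / real d"
        using d(1) by (simp add: diff_divide_distrib)
      then show ?thesis by simp
    qed
    also have "\<dots> \<le> 2 * \<delta> / real d"
      using \<open>\<bar>coeff f 1 * real d - r\<bar> \<le> 2 * \<delta>\<close> by (rule divide_right_mono) simp
    finally have "c / (real d)\<^sup>2 \<le> 2 * \<delta> / real d" using d(1) by simp
    then have "c \<le> 2 * \<delta> / real d * (real d)\<^sup>2" using d(1) by (simp add: pos_divide_le_eq)
    also have "\<dots> = 2 * \<delta> * real d" using d(1) by (simp add: power2_eq_square)
    finally show ?thesis by (simp add: d(2))
  qed
  \<comment> \<open>The summand \<open>c / X\<close> keeps \<open>h\<close> finite when \<open>\<delta> = 0\<close>, at the price of one additional point.\<close>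
  define h where "h = c / (2 * \<delta> + c / X)"
  have pos: "2 * \<delta> + c / X > 0" using c X \<delta> by (simp add: add_nonneg_pos)
  have h: "h > 0" using pos c by (simp add: h_def)
  have one: "real (card {z\<in>?A. x \<le> z \<and> real_of_int z < real_of_int x + h}) \<le> 1 / h * h" if x: "x \<in> ?A" for x
  proof -
    have "{z\<in>?A. x \<le> z \<and> real_of_int z < real_of_int x + h} \<subseteq> {x}"
    proof
      fix z assume z: "z \<in> {z\<in>?A. x \<le> z \<and> real_of_int z < real_of_int x + h}"
      show "z \<in> {x}"
      proof (rule ccontr)
        assume "z \<notin> {x}"
        then have xz: "x < z" using z by simp
        have "c \<le> 2 * \<delta> * real_of_int (z - x)" using gap[OF x _ xz] z by simp
        also have "\<dots> \<le> (2 * \<delta> + c / X) * real_of_int (z - x)"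
          using xz c X by (intro mult_right_mono) auto
        also have "\<dots> < (2 * \<delta> + c / X) * h"
          using z pos by (intro mult_strict_left_mono) auto
        also have "\<dots> = c" using pos by (simp add: h_def)
        finally show False by simp
      qed
    qed
    then have "card {z\<in>?A. x \<le> z \<and> real_of_int z < real_of_int x + h} \<le> card {x}"
      by (intro card_mono) auto
    then show ?thesis using h by simp
  qed
  have "real (card ?A) \<le> 1 / h * (2 * X - X + h)"
    by (rule cover_count[OF finite_near_points _ _ _ near_points_bounds])
       (use h X one in \<open>auto intro!: exI[of _ h]\<close>)
  also have "\<dots> = X / h + 1" using h by (simp add: field_simps)
  also have "X / h = (2 / c) * (\<delta> * X) + 1" using c X by (simp add: h_def field_simps)
  also have "(2 / c) * (\<delta> * X) + 1 + 1 \<le> (2 / c + 2) * (\<delta> * X + 1)"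
  proof -
    have "0 \<le> 2 / c" "0 \<le> \<delta> * X" using c \<delta> X by simp_all
    then show ?thesis by (simp only: distrib_left distrib_right)
  qed
  finally show ?thesis using lattice_count_le[OF \<delta>(2), of f X] by linarith
qed

theorem corollary1p2:
  "(\<forall>(n::nat) (\<epsilon>::real) (c1::real). n \<ge> 1 \<and> \<epsilon> > 0 \<and> c1 > 0 \<longrightarrow>
      (\<exists>C::real. C > 0 \<and>
        (\<forall>(f::real poly) (\<delta>::real) (X::real).
           degree f = n \<and> 0 \<le> \<delta> \<and> \<delta> \<le> 1/4 \<and> X \<ge> 2 \<and>
           (\<forall>(r::int) (s::nat). s \<ge> 1 \<longrightarrow>
              \<bar>coeff f n - real_of_int r / real s\<bar> \<ge> c1 / real s powr ((real n + 3) / 2))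
           \<longrightarrow> real (lattice_count f \<delta> X)
                 \<le> C * (\<delta> powr (2 / (real n * (real n + 1))) * X + X powr \<epsilon>)))) \<and>
   (\<forall>c1::real. c1 > 0 \<longrightarrow>
      (\<exists>C'::real. C' > 0 \<and>
        (\<forall>(f::real poly) (\<delta>::real) (X::real).
           degree f = 1 \<and> 0 \<le> \<delta> \<and> \<delta> \<le> 1/4 \<and> X \<ge> 2 \<and>
           (\<forall>(r::int) (s::nat). s \<ge> 1 \<longrightarrow>
              \<bar>coeff f 1 - real_of_int r / real s\<bar> \<ge> c1 / real s powr ((real 1 + 3) / 2))
           \<longrightarrow> real (lattice_count f \<delta> X) \<le> C' * (\<delta> * X + 1))))"
proof (intro conjI allI impI)
  fix c1 :: real assume c1: "c1 > 0"
  show "\<exists>C'::real. C' > 0 \<and>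
        (\<forall>(f::real poly) (\<delta>::real) (X::real).
           degree f = 1 \<and> 0 \<le> \<delta> \<and> \<delta> \<le> 1/4 \<and> X \<ge> 2 \<and>
           (\<forall>(r::int) (s::nat). s \<ge> 1 \<longrightarrow>
              \<bar>coeff f 1 - real_of_int r / real s\<bar> \<ge> c1 / real s powr ((real 1 + 3) / 2))
           \<longrightarrow> real (lattice_count f \<delta> X) \<le> C' * (\<delta> * X + 1))"
  proof (intro exI[of _ "2 / c1 + 2"] conjI allI impI)
    show "2 / c1 + 2 > 0" using c1 by (simp add: add_pos_pos)
    fix f :: "real poly" and \<delta> X :: real
    assume H: "degree f = 1 \<and> 0 \<le> \<delta> \<and> \<delta> \<le> 1/4 \<and> X \<ge> 2 \<and>
           (\<forall>(r::int) (s::nat). s \<ge> 1 \<longrightarrow>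
              \<bar>coeff f 1 - real_of_int r / real s\<bar> \<ge> c1 / real s powr ((real 1 + 3) / 2))"
    have "poorly_approximable c1 ((real 1 + 3) / 2) (coeff f 1)"
      unfolding poorly_approximable_def using H by blast
    then have "poorly_approximable c1 2 (coeff f 1)" by simp
    then show "real (lattice_count f \<delta> X) \<le> (2 / c1 + 2) * (\<delta> * X + 1)"
      using H c1 by (intro lattice_count_linear) auto
  qed
next
  fix n :: nat and \<epsilon> c1 :: real assume asm: "n \<ge> 1 \<and> \<epsilon> > 0 \<and> c1 > 0"
  show "\<exists>C::real. C > 0 \<and>
        (\<forall>(f::real poly) (\<delta>::real) (X::real).
           degree f = n \<and> 0 \<le> \<delta> \<and> \<delta> \<le> 1/4 \<and> X \<ge> 2 \<and>
           (\<forall>(r::int) (s::nat). s \<ge> 1 \<longrightarrow>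
              \<bar>coeff f n - real_of_int r / real s\<bar> \<ge> c1 / real s powr ((real n + 3) / 2))
           \<longrightarrow> real (lattice_count f \<delta> X)
                 \<le> C * (\<delta> powr (2 / (real n * (real n + 1))) * X + X powr \<epsilon>))"
  proof (cases "n = 1")
    case True
    show ?thesis
    proof (intro exI[of _ "2 / c1 + 2"] conjI allI impI)
      show pos: "2 / c1 + 2 > 0" using asm by (simp add: add_pos_pos)
      fix f :: "real poly" and \<delta> X :: real
      assume H: "degree f = n \<and> 0 \<le> \<delta> \<and> \<delta> \<le> 1/4 \<and> X \<ge> 2 \<and>
           (\<forall>(r::int) (s::nat). s \<ge> 1 \<longrightarrow>
              \<bar>coeff f n - real_of_int r / real s\<bar> \<ge> c1 / real s powr ((real n + 3) / 2))"
      have "poorly_approximable c1 ((real n + 3) / 2) (coeff f n)"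
        unfolding poorly_approximable_def using H by blast
      then have "poorly_approximable c1 2 (coeff f 1)" using True by simp
      then have "real (lattice_count f \<delta> X) \<le> (2 / c1 + 2) * (\<delta> * X + 1)"
        using H asm True by (intro lattice_count_linear) auto
      also have "\<dots> \<le> (2 / c1 + 2) * (\<delta> * X + X powr \<epsilon>)"
        using H asm pos by (intro mult_left_mono add_left_mono ge_one_powr_ge_zero) auto
      also have "\<dots> = (2 / c1 + 2) * (\<delta> powr (2 / (real n * (real n + 1))) * X + X powr \<epsilon>)"
        using H True by simp
      finally show "real (lattice_count f \<delta> X)
          \<le> (2 / c1 + 2) * (\<delta> powr (2 / (real n * (real n + 1))) * X + X powr \<epsilon>)" .
    qed
  next
    case False
    then have n: "n \<ge> 2" using asm by simp
    obtain C where C: "C > 0" and bound: "\<And>f \<delta> X. degree f \<le> n \<Longrightarrow>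
       poorly_approximable c1 ((real n + 3) / 2) (coeff f n) \<Longrightarrow> 0 \<le> \<delta> \<Longrightarrow> \<delta> \<le> 1 / 4 \<Longrightarrow> X \<ge> 2 \<Longrightarrow>
       real (lattice_count f \<delta> X) \<le> C * (\<delta> powr (2 / (real n * (real n + 1))) * X + X powr \<epsilon>)"
      using lattice_count_higher[OF n] asm by blast
    show ?thesis
    proof (intro exI[of _ C] conjI allI impI)
      show "C > 0" by fact
      fix f :: "real poly" and \<delta> X :: real
      assume H: "degree f = n \<and> 0 \<le> \<delta> \<and> \<delta> \<le> 1/4 \<and> X \<ge> 2 \<and>
           (\<forall>(r::int) (s::nat). s \<ge> 1 \<longrightarrow>
              \<bar>coeff f n - real_of_int r / real s\<bar> \<ge> c1 / real s powr ((real n + 3) / 2))"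
      have "poorly_approximable c1 ((real n + 3) / 2) (coeff f n)"
        unfolding poorly_approximable_def using H by blast
      then show "real (lattice_count f \<delta> X)
          \<le> C * (\<delta> powr (2 / (real n * (real n + 1))) * X + X powr \<epsilon>)"
        using H by (intro bound) auto
    qed
  qed
qed

end
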